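(* Let $(\omega,J,g)$ be a compatible triple on a transitive Lie algebroid $\mathcal{A}$ over $M$ such that $g$ is invariant and $J$ is admissible. Let $L=\ker\rho$ and let $(\omega_M,J_M,g_M)$ be the induced compatible triple on $M$. Then: (1) the bracket of every two sections of $L$ is zero; (2) $(\mathcal{A},\omega,J,g)$ is Kähler if and only if $(M,\omega_M,J_M,g_M)$ is Kähler.
   Context: A Lie algebroid over $M$ is a vector bundle $\mathcal{A}\to M$ with a Lie bracket $[\,,]$ on $\Gamma(\mathcal{A})$ and a bundle map $\rho:\mathcal{A}\to TM$ (anchor) which is a Lie algebra homomorphism on sections and satisfies $[S_1,fS_2]=f[S_1,S_2]+(\rho(S_1)\cdot f)S_2$; it is transitive if $\rho$ is surjective. A symplectic form on $\mathcal{A}$ is a nondegenerate section $\omega$ of $\wedge^2\mathcal{A}^*$ closed under the Lie algebroid exterior derivative. An almost complex structure on $\mathcal{A}$ is a bundle endomorphism $J$ over the identity with $J^2=-\mathrm{id}$. A compatible triple $(\omega,J,g)$ consists of a symplectic form, an almost complex structure and a Riemannian metric on $\mathcal{A}$ with $g(J(S),J(T))=g(S,T)$ and $\omega(S,T)=g(S,J(T))$. $J$ is admissible if there is an almost complex structure $J_M$ on $M$ with $\rho\circ J=J_M\circ\rho$. Invariant metric: for a splitting $\lambda:TM\to\mathcal{A}$ (a vector bundle map with $\rho\circ\lambda=\mathrm{id}_{TM}$), the adjoint connection on $L$ is $\nabla^{\lambda}_XT=[\lambda(X),T]$. The metric $g$ is invariant if $\nabla^{\lambda}_X(g|_L)=0$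 for every splitting $\lambda$ and every $X\in\mathcal{X}(M)$. An invariant metric is understood to satisfy $g([S_1,S_2],S_3)=g(S_1,[S_2,S_3])$ for $S_1,S_2,S_3\in\Gamma(L)$ (this is automatic when $\dim M>0$). Induced triple on $M$: under these hypotheses $\omega|_L$ is nondegenerate, $\mathcal{A}=E\oplus L$ with $E=L^{\omega}=\{a:\omega(a,s)=0\ \forall s\in L\}$, and $\omega_M(\rho(a),\rho(b))=\omega(a,b)$, $J_M(\rho(a))=\rho(J(a))$, $g_M(\rho(a),\rho(b))=g(a,b)$ for $a,b\in E$; $(\omega_M,J_M,g_M)$ is a compatible triple on $M$ (i.e. on the Lie algebroid $TM$). A Lie algebroid with compatible triple $(\omega,J,g)$ is Kähler if the Nijenhuis tensor $N_J(a,b)=[Ja,Jb]-[a,b]-J[Ja,b]-J[a,Jb]$ vanishes; $M$ is Kähler if this holds for $TM$ with $(\omega_M,J_M,g_M)$. *)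

theory Defs
  imports "HOL-Analysis.Analysis"
begin

text \<open>
  Model spaces for charts and for fibres are finite-dimensional real inner product spaces.
  The class \<open>real_inner\<close> with an explicit finiteness condition is used instead of
  \<open>euclidean_space\<close>, because the latter excludes dimension 0 (a Lie algebroid over a
  0-dimensional base, or of rank 0, is legitimate).
\<close>

definition finite_dim :: "'e::real_inner itself \<Rightarrow> bool" where
  "finite_dim _ \<longleftrightarrow> (\<exists>B::'e set. finite B \<and> span B = UNIV)"

text \<open>The one-point type provides the 0-dimensional model space.\<close>

instantiation unit :: real_inner
begin

definition zero_unit :: unit where "zero_unit = ()"
definition plus_unit :: "unit \<Rightarrow> unit \<Rightarrow> unit" where "plus_unit _ _ = ()"
definition minus_unit :: "unit \<Rightarrow> unit \<Rightarrow> unit" where "minus_unit _ _ = ()"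
definition uminus_unit :: "unit \<Rightarrow> unit" where "uminus_unit _ = ()"
definition scaleR_unit :: "real \<Rightarrow> unit \<Rightarrow> unit" where "scaleR_unit _ _ = ()"
definition inner_unit :: "unit \<Rightarrow> unit \<Rightarrow> real" where "inner_unit _ _ = 0"
definition norm_unit :: "unit \<Rightarrow> real" where "norm_unit _ = 0"
definition dist_unit :: "unit \<Rightarrow> unit \<Rightarrow> real" where "dist_unit _ _ = 0"
definition sgn_unit :: "unit \<Rightarrow> unit" where "sgn_unit _ = ()"
definition uniformity_unit :: "(unit \<times> unit) filter" where
  "uniformity_unit = (INF e\<in>{0<..}. principal {(x, y). dist x y < e})"
definition open_unit :: "unit set \<Rightarrow> bool" where
  "open_unit U \<longleftrightarrow> (\<forall>x\<in>U. eventually (\<lambda>(x', y). x' = x \<longrightarrow> y \<in> U) uniformity)"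

instance
  by standard (simp_all add: uniformity_unit_def open_unit_def inner_unit_def norm_unit_def
      dist_unit_def)

end

lemma finite_dim_unit: "finite_dim TYPE(unit)"
proof -
  have "span {} = (UNIV::unit set)"
    by (auto simp: zero_unit_def)
  then show ?thesis
    unfolding finite_dim_def by (metis finite.emptyI)
qed

lemma finite_dim_euclidean: "finite_dim TYPE('e::euclidean_space)"
  unfolding finite_dim_def using finite_Basis span_Basis by blast

section \<open>Smooth functions and manifolds\<close>

text \<open>\<open>Ck_on\<close> and \<open>smooth_on\<close> are meant for open \<open>S\<close> in finite dimension,
  where continuity of all iterated directional derivatives is the usual notion.\<close>

primrec Ck_on :: "nat \<Rightarrow> 'e::real_inner set \<Rightarrow> ('e \<Rightarrow> 'f::real_normed_vector) \<Rightarrow> bool" where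
  "Ck_on 0 S f \<longleftrightarrow> continuous_on S f"
| "Ck_on (Suc k) S f \<longleftrightarrow>
     (\<forall>x\<in>S. f differentiable (at x)) \<and>
     (\<forall>v. Ck_on k S (\<lambda>x. frechet_derivative f (at x) v))"

definition smooth_on :: "'e::real_inner set \<Rightarrow> ('e \<Rightarrow> 'f::real_normed_vector) \<Rightarrow> bool" where
  "smooth_on S f \<longleftrightarrow> (\<forall>k. Ck_on k S f)"

text \<open>A chart is its domain together with its coordinate map, whose values off the
  domain are irrelevant.\<close>

type_synonym ('m, 'e) chart = "'m set \<times> ('m \<Rightarrow> 'e)"

abbreviation chart_inv :: "('m, 'e) chart \<Rightarrow> 'e \<Rightarrow> 'm" where
  "chart_inv c \<equiv> inv_into (fst c) (snd c)"

definition is_chart :: "('m::topological_space, 'e::real_inner) chart \<Rightarrow> bool" where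
  "is_chart c \<longleftrightarrow> open (fst c) \<and> open (snd c ` fst c) \<and>
     homeomorphism (fst c) (snd c ` fst c) (snd c) (chart_inv c)"

text \<open>The underlying space of the manifold is the whole type \<open>'m\<close>; the smooth structure
  is given by an atlas \<open>M\<close>.\<close>

definition smooth_manifold ::
  "('m::{t2_space,second_countable_topology}, 'e::real_inner) chart set \<Rightarrow> bool" where
  "smooth_manifold M \<longleftrightarrow>
     finite_dim TYPE('e) \<and>
     (\<forall>c\<in>M. is_chart c) \<and>
     (\<Union>c\<in>M. fst c) = UNIV \<and>
     (\<forall>c\<in>M. \<forall>d\<in>M. smooth_on (snd c ` (fst c \<inter> fst d)) (snd d \<circ> chart_inv c))"

definition smooth_map_on ::
  "('m::topological_space, 'e::real_inner) chart set \<Rightarrow> 'm set \<Rightarrow>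
   ('m \<Rightarrow> 'f::real_normed_vector) \<Rightarrow> bool" where
  "smooth_map_on M W f \<longleftrightarrow> (\<forall>c\<in>M. smooth_on (snd c ` (fst c \<inter> W)) (f \<circ> chart_inv c))"

definition chart_at :: "('m, 'e) chart set \<Rightarrow> 'm \<Rightarrow> ('m, 'e) chart" where
  "chart_at M p = (SOME c. c \<in> M \<and> p \<in> fst c)"

section \<open>Vector bundles\<close>

text \<open>
  A vector bundle is a family of vector spaces \<open>fibre E p\<close> with an atlas of local
  trivialisations \<open>(U, \<Phi>)\<close>, where \<open>\<Phi> p\<close> is a linear isomorphism from the
  fibre over \<open>p \<in> U\<close> to the typical fibre \<open>'f\<close> and the transition maps are smooth.
  All fibres are subspaces of one real vector space \<open>'v\<close>, which carries no topology
  and may be infinite-dimensional, so this is no restriction (embed the fibres in their direct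
  sum).  The total space is the disjoint union \<open>Sigma UNIV (fibre E)\<close>; fibres over different
  points may overlap inside \<open>'v\<close>.
\<close>

record ('m, 'v, 'f) vbundle =
  fibre :: "'m \<Rightarrow> 'v set"
  trivs :: "('m set \<times> ('m \<Rightarrow> 'v \<Rightarrow> 'f)) set"

abbreviation triv_inv :: "('m, 'v, 'f, 'z) vbundle_scheme \<Rightarrow> ('m \<Rightarrow> 'v \<Rightarrow> 'f) \<Rightarrow> 'm \<Rightarrow> 'f \<Rightarrow> 'v" where
  "triv_inv E \<Phi> p \<equiv> inv_into (fibre E p) (\<Phi> p)"

definition linear_between ::
  "'v::real_vector set \<Rightarrow> 'w::real_vector set \<Rightarrow> ('v \<Rightarrow> 'w) \<Rightarrow> bool" where
  "linear_between V W h \<longleftrightarrow> h ` V \<subseteq> W \<and>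
     (\<forall>a\<in>V. \<forall>b\<in>V. h (a + b) = h a + h b) \<and> (\<forall>r. \<forall>a\<in>V. h (r *\<^sub>R a) = r *\<^sub>R h a)"

definition vector_bundle ::
  "('m::{t2_space,second_countable_topology}, 'e::real_inner) chart set \<Rightarrow>
   ('m, 'v::real_vector, 'f::real_inner, 'z) vbundle_scheme \<Rightarrow> bool" where
  "vector_bundle M E \<longleftrightarrow>
     finite_dim TYPE('f) \<and>
     (\<forall>p. subspace (fibre E p)) \<and>
     (\<forall>(U, \<Phi>)\<in>trivs E. open U \<and>
        (\<forall>p\<in>U. linear_between (fibre E p) UNIV (\<Phi> p) \<and> bij_betw (\<Phi> p) (fibre E p) UNIV)) \<and>
     (\<Union>(U, \<Phi>)\<in>trivs E. U) = UNIV \<and>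
     (\<forall>(U, \<Phi>)\<in>trivs E. \<forall>(W, \<Psi>)\<in>trivs E. \<forall>x.
        smooth_map_on M (U \<inter> W) (\<lambda>p. \<Psi> p (triv_inv E \<Phi> p x)))"

definition sections ::
  "('m::topological_space, 'e::real_inner) chart set \<Rightarrow>
   ('m, 'v::real_vector, 'f::real_inner, 'z) vbundle_scheme \<Rightarrow> ('m \<Rightarrow> 'v) set" where
  "sections M E = {s. (\<forall>p. s p \<in> fibre E p) \<and>
     (\<forall>(U, \<Phi>)\<in>trivs E. smooth_map_on M U (\<lambda>p. \<Phi> p (s p)))}"

text \<open>Smooth vector bundle maps over the identity of \<open>M\<close>.\<close>

definition bundle_map ::
  "('m::topological_space, 'e::real_inner) chart set \<Rightarrow>
   ('m, 'v::real_vector, 'f::real_inner, 'y) vbundle_scheme \<Rightarrow>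
   ('m, 'w::real_vector, 'g::real_inner, 'z) vbundle_scheme \<Rightarrow> ('m \<Rightarrow> 'v \<Rightarrow> 'w) \<Rightarrow> bool" where
  "bundle_map M E F h \<longleftrightarrow>
     (\<forall>p. linear_between (fibre E p) (fibre F p) (h p)) \<and>
     (\<forall>(U, \<Phi>)\<in>trivs E. \<forall>(W, \<Psi>)\<in>trivs F. \<forall>x.
        smooth_map_on M (U \<inter> W) (\<lambda>p. \<Psi> p (h p (triv_inv E \<Phi> p x))))"

text \<open>Smooth sections of \<open>E\<^sup>* \<otimes> E\<^sup>*\<close>.\<close>

definition bilinear_form ::
  "('m::topological_space, 'e::real_inner) chart set \<Rightarrow>
   ('m, 'v::real_vector, 'f::real_inner, 'z) vbundle_scheme \<Rightarrow> ('m \<Rightarrow> 'v \<Rightarrow> 'v \<Rightarrow> real) \<Rightarrow> bool" where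
  "bilinear_form M E \<beta> \<longleftrightarrow>
     (\<forall>p. \<forall>a\<in>fibre E p. linear_between (fibre E p) UNIV (\<beta> p a) \<and>
                        linear_between (fibre E p) UNIV (\<lambda>b. \<beta> p b a)) \<and>
     (\<forall>(U, \<Phi>)\<in>trivs E. \<forall>x y.
        smooth_map_on M U (\<lambda>p. \<beta> p (triv_inv E \<Phi> p x) (triv_inv E \<Phi> p y)))"

section \<open>Lie algebroids\<close>

text \<open>
  The tangent space at \<open>p\<close> is the model space \<open>'e\<close>: a tangent vector is represented by
  its coordinates in the chart \<open>chart_at M p\<close>.  Its coordinates in another chart \<open>c\<close>
  around \<open>p\<close> are obtained by applying the derivative of the coordinate change; these maps are
  the local trivialisations of the tangent bundle.
\<close>

definition tangent_coord ::
  "('m, 'e::real_inner) chart set \<Rightarrow> ('m, 'e) chart \<Rightarrow> 'm \<Rightarrow> 'e \<Rightarrow> 'e" where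
  "tangent_coord M c p v =
     frechet_derivative (snd c \<circ> chart_inv (chart_at M p)) (at (snd (chart_at M p) p)) v"

text \<open>The derivative \<open>v \<cdot> f\<close> of a function along a tangent vector at \<open>p\<close>.\<close>

definition dir_deriv ::
  "('m, 'e::real_inner) chart set \<Rightarrow> 'm \<Rightarrow> 'e \<Rightarrow> ('m \<Rightarrow> real) \<Rightarrow> real" where
  "dir_deriv M p v f =
     frechet_derivative (f \<circ> chart_inv (chart_at M p)) (at (snd (chart_at M p) p)) v"

text \<open>
  Lie bracket of vector fields, \<open>[X,Y] = DY(X) - DX(Y)\<close> in the coordinates of
  \<open>chart_at M p\<close>; it satisfies \<open>[X,Y] \<cdot> f = X \<cdot> (Y \<cdot> f) - Y \<cdot> (X \<cdot> f)\<close>.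
\<close>

definition vf_bracket ::
  "('m, 'e::real_inner) chart set \<Rightarrow> ('m \<Rightarrow> 'e) \<Rightarrow> ('m \<Rightarrow> 'e) \<Rightarrow> 'm \<Rightarrow> 'e" where
  "vf_bracket M X Y p =
     (let c = chart_at M p;
          coords = (\<lambda>Z x. tangent_coord M c (chart_inv c x) (Z (chart_inv c x)))
      in frechet_derivative (coords Y) (at (snd c p)) (X p)
       - frechet_derivative (coords X) (at (snd c p)) (Y p))"

text \<open>The values of \<open>bracket\<close> matter on smooth sections only.\<close>

record ('m, 'v, 'f, 'e) lie_algebroid = "('m, 'v, 'f) vbundle" +
  anchor :: "'m \<Rightarrow> 'v \<Rightarrow> 'e"
  bracket :: "('m \<Rightarrow> 'v) \<Rightarrow> ('m \<Rightarrow> 'v) \<Rightarrow> ('m \<Rightarrow> 'v)"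

definition tangent_algebroid ::
  "('m, 'e::real_inner) chart set \<Rightarrow> ('m, 'e, 'e, 'e) lie_algebroid" where
  "tangent_algebroid M =
     \<lparr> fibre = (\<lambda>p. UNIV),
       trivs = (\<lambda>c. (fst c, tangent_coord M c)) ` M,
       anchor = (\<lambda>p v. v),
       bracket = vf_bracket M \<rparr>"

definition anchor_sec ::
  "('m, 'v, 'f, 'e) lie_algebroid \<Rightarrow> ('m \<Rightarrow> 'v) \<Rightarrow> 'm \<Rightarrow> 'e" where
  "anchor_sec A S = (\<lambda>p. anchor A p (S p))"

definition vf_apply ::
  "('m, 'e::real_inner) chart set \<Rightarrow> ('m \<Rightarrow> 'e) \<Rightarrow> ('m \<Rightarrow> real) \<Rightarrow> 'm \<Rightarrow> real" where
  "vf_apply M X f = (\<lambda>p. dir_deriv M p (X p) f)"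

definition lie_algebroid ::
  "('m::{t2_space,second_countable_topology}, 'e::real_inner) chart set \<Rightarrow>
   ('m, 'v::real_vector, 'f::real_inner, 'e) lie_algebroid \<Rightarrow> bool" where
  "lie_algebroid M A \<longleftrightarrow>
     vector_bundle M A \<and>
     bundle_map M A (tangent_algebroid M) (anchor A) \<and>
     (\<forall>S\<in>sections M A. \<forall>T\<in>sections M A. bracket A S T \<in> sections M A) \<and>
     (\<forall>S\<in>sections M A. \<forall>T\<in>sections M A. \<forall>R\<in>sections M A.
        bracket A (\<lambda>p. S p + T p) R = (\<lambda>p. bracket A S R p + bracket A T R p)) \<and>
     (\<forall>r. \<forall>S\<in>sections M A. \<forall>T\<in>sections M A.
        bracket A (\<lambda>p. r *\<^sub>R S p) T = (\<lambda>p. r *\<^sub>R bracket A S T p)) \<and>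
     (\<forall>S\<in>sections M A. \<forall>T\<in>sections M A. bracket A S T = (\<lambda>p. - bracket A T S p)) \<and>
     (\<forall>S\<in>sections M A. \<forall>T\<in>sections M A. \<forall>R\<in>sections M A. \<forall>p.
        bracket A S (bracket A T R) p + bracket A T (bracket A R S) p
          + bracket A R (bracket A S T) p = 0) \<and>
     (\<forall>S\<in>sections M A. \<forall>T\<in>sections M A.
        anchor_sec A (bracket A S T) = vf_bracket M (anchor_sec A S) (anchor_sec A T)) \<and>
     (\<forall>f. smooth_map_on M UNIV f \<longrightarrow> (\<forall>S\<in>sections M A. \<forall>T\<in>sections M A.
        bracket A S (\<lambda>p. f p *\<^sub>R T p) =
          (\<lambda>p. f p *\<^sub>R bracket A S T p + vf_apply M (anchor_sec A S) f p *\<^sub>R T p)))"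

definition transitive :: "('m, 'v, 'f, 'e) lie_algebroid \<Rightarrow> bool" where
  "transitive A \<longleftrightarrow> (\<forall>p. anchor A p ` fibre A p = UNIV)"

text \<open>The kernel \<open>L\<close> of the anchor and its smooth sections.\<close>

definition isotropy :: "('m, 'v, 'f, 'e::real_inner) lie_algebroid \<Rightarrow> 'm \<Rightarrow> 'v set" where
  "isotropy A p = {a \<in> fibre A p. anchor A p a = 0}"

definition isotropy_sections ::
  "('m::topological_space, 'e::real_inner) chart set \<Rightarrow>
   ('m, 'v::real_vector, 'f::real_inner, 'e) lie_algebroid \<Rightarrow> ('m \<Rightarrow> 'v) set" where
  "isotropy_sections M A = {S \<in> sections M A. \<forall>p. S p \<in> isotropy A p}"

section \<open>Compatible triples\<close>

definition ext_deriv2 ::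
  "('m, 'e::real_inner) chart set \<Rightarrow> ('m, 'v, 'f, 'e) lie_algebroid \<Rightarrow>
   ('m \<Rightarrow> 'v \<Rightarrow> 'v \<Rightarrow> real) \<Rightarrow> ('m \<Rightarrow> 'v) \<Rightarrow> ('m \<Rightarrow> 'v) \<Rightarrow> ('m \<Rightarrow> 'v) \<Rightarrow> 'm \<Rightarrow> real" where
  "ext_deriv2 M A \<omega> R S T p =
     vf_apply M (anchor_sec A R) (\<lambda>q. \<omega> q (S q) (T q)) p
     - vf_apply M (anchor_sec A S) (\<lambda>q. \<omega> q (R q) (T q)) p
     + vf_apply M (anchor_sec A T) (\<lambda>q. \<omega> q (R q) (S q)) p
     - \<omega> p (bracket A R S p) (T p)
     + \<omega> p (bracket A R T p) (S p)
     - \<omega> p (bracket A S T p) (R p)"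

definition symplectic_form ::
  "('m::topological_space, 'e::real_inner) chart set \<Rightarrow>
   ('m, 'v::real_vector, 'f::real_inner, 'e) lie_algebroid \<Rightarrow>
   ('m \<Rightarrow> 'v \<Rightarrow> 'v \<Rightarrow> real) \<Rightarrow> bool" where
  "symplectic_form M A \<omega> \<longleftrightarrow>
     bilinear_form M A \<omega> \<and>
     (\<forall>p. \<forall>a\<in>fibre A p. \<omega> p a a = 0) \<and>
     (\<forall>p. \<forall>a\<in>fibre A p. (\<forall>b\<in>fibre A p. \<omega> p a b = 0) \<longrightarrow> a = 0) \<and>
     (\<forall>R\<in>sections M A. \<forall>S\<in>sections M A. \<forall>T\<in>sections M A. \<forall>p. ext_deriv2 M A \<omega> R S T p = 0)"

definition almost_complex ::
  "('m::topological_space, 'e::real_inner) chart set \<Rightarrow>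
   ('m, 'v::real_vector, 'f::real_inner, 'e) lie_algebroid \<Rightarrow> ('m \<Rightarrow> 'v \<Rightarrow> 'v) \<Rightarrow> bool" where
  "almost_complex M A J \<longleftrightarrow>
     bundle_map M A A J \<and> (\<forall>p. \<forall>a\<in>fibre A p. J p (J p a) = - a)"

definition riemannian_metric ::
  "('m::topological_space, 'e::real_inner) chart set \<Rightarrow>
   ('m, 'v::real_vector, 'f::real_inner, 'e) lie_algebroid \<Rightarrow>
   ('m \<Rightarrow> 'v \<Rightarrow> 'v \<Rightarrow> real) \<Rightarrow> bool" where
  "riemannian_metric M A g \<longleftrightarrow>
     bilinear_form M A g \<and>
     (\<forall>p. \<forall>a\<in>fibre A p. \<forall>b\<in>fibre A p. g p a b = g p b a) \<and>
     (\<forall>p. \<forall>a\<in>fibre A p. a \<noteq> 0 \<longrightarrow> g p a a > 0)"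

definition compatible_triple ::
  "('m::topological_space, 'e::real_inner) chart set \<Rightarrow>
   ('m, 'v::real_vector, 'f::real_inner, 'e) lie_algebroid \<Rightarrow>
   ('m \<Rightarrow> 'v \<Rightarrow> 'v \<Rightarrow> real) \<Rightarrow> ('m \<Rightarrow> 'v \<Rightarrow> 'v) \<Rightarrow> ('m \<Rightarrow> 'v \<Rightarrow> 'v \<Rightarrow> real) \<Rightarrow> bool" where
  "compatible_triple M A \<omega> J g \<longleftrightarrow>
     symplectic_form M A \<omega> \<and> almost_complex M A J \<and> riemannian_metric M A g \<and>
     (\<forall>p. \<forall>a\<in>fibre A p. \<forall>b\<in>fibre A p.
        g p (J p a) (J p b) = g p a b \<and> \<omega> p a b = g p a (J p b))"

definition admissible ::
  "('m::topological_space, 'e::real_inner) chart set \<Rightarrow>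
   ('m, 'v::real_vector, 'f::real_inner, 'e) lie_algebroid \<Rightarrow> ('m \<Rightarrow> 'v \<Rightarrow> 'v) \<Rightarrow> bool" where
  "admissible M A J \<longleftrightarrow> (\<exists>J\<^sub>M. almost_complex M (tangent_algebroid M) J\<^sub>M \<and>
     (\<forall>p. \<forall>a\<in>fibre A p. anchor A p (J p a) = J\<^sub>M p (anchor A p a)))"

definition splitting ::
  "('m::topological_space, 'e::real_inner) chart set \<Rightarrow>
   ('m, 'v::real_vector, 'f::real_inner, 'e) lie_algebroid \<Rightarrow> ('m \<Rightarrow> 'e \<Rightarrow> 'v) \<Rightarrow> bool" where
  "splitting M A \<sigma> \<longleftrightarrow>
     bundle_map M (tangent_algebroid M) A \<sigma> \<and> (\<forall>p v. anchor A p (\<sigma> p v) = v)"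

definition adjoint_connection ::
  "('m, 'v, 'f, 'e) lie_algebroid \<Rightarrow> ('m \<Rightarrow> 'e \<Rightarrow> 'v) \<Rightarrow> ('m \<Rightarrow> 'e) \<Rightarrow> ('m \<Rightarrow> 'v) \<Rightarrow> 'm \<Rightarrow> 'v" where
  "adjoint_connection A \<sigma> X T = bracket A (\<lambda>p. \<sigma> p (X p)) T"

text \<open>
  The first clause is \<open>(\<nabla>\<^sub>X g)(S, T) = X \<cdot> g(S, T) - g(\<nabla>\<^sub>X S, T) - g(S, \<nabla>\<^sub>X T) = 0\<close> on \<open>L\<close>.
  The second clause is part of the notion by convention; it follows from the first when the base
  has positive dimension.
\<close>

definition invariant_metric ::
  "('m::topological_space, 'e::real_inner) chart set \<Rightarrow>
   ('m, 'v::real_vector, 'f::real_inner, 'e) lie_algebroid \<Rightarrow>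
   ('m \<Rightarrow> 'v \<Rightarrow> 'v \<Rightarrow> real) \<Rightarrow> bool" where
  "invariant_metric M A g \<longleftrightarrow>
     (\<forall>\<sigma>. splitting M A \<sigma> \<longrightarrow>
        (\<forall>X\<in>sections M (tangent_algebroid M).
         \<forall>S\<in>isotropy_sections M A. \<forall>T\<in>isotropy_sections M A. \<forall>p.
           vf_apply M X (\<lambda>q. g q (S q) (T q)) p
           - g p (adjoint_connection A \<sigma> X S p) (T p)
           - g p (S p) (adjoint_connection A \<sigma> X T p) = 0)) \<and>
     (\<forall>R\<in>isotropy_sections M A. \<forall>S\<in>isotropy_sections M A. \<forall>T\<in>isotropy_sections M A. \<forall>p.
        g p (bracket A R S p) (T p) = g p (R p) (bracket A S T p))"

text \<open>The subbundle \<open>E = L\<^sup>\<omega>\<close>.\<close>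

definition horizontal ::
  "('m, 'v, 'f, 'e::real_inner) lie_algebroid \<Rightarrow> ('m \<Rightarrow> 'v \<Rightarrow> 'v \<Rightarrow> real) \<Rightarrow> 'm \<Rightarrow> 'v set" where
  "horizontal A \<omega> p = {a \<in> fibre A p. \<forall>s\<in>isotropy A p. \<omega> p a s = 0}"

text \<open>
  For a transitive algebroid with admissible \<open>J\<close>, the anchor maps \<open>E\<close> isomorphically onto
  the tangent space, so each tangent vector is \<open>\<rho>(a)\<close> for exactly one \<open>a \<in> E\<close>.  The
  induced triple is \<open>\<omega>\<^sub>M(\<rho>(a), \<rho>(b)) = \<omega>(a, b)\<close>, \<open>J\<^sub>M(\<rho>(a)) = \<rho>(J(a))\<close>,
  \<open>g\<^sub>M(\<rho>(a), \<rho>(b)) = g(a, b)\<close> for \<open>a, b \<in> E\<close>.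
\<close>

definition horizontal_lift ::
  "('m, 'v, 'f, 'e::real_inner) lie_algebroid \<Rightarrow> ('m \<Rightarrow> 'v \<Rightarrow> 'v \<Rightarrow> real) \<Rightarrow> 'm \<Rightarrow> 'e \<Rightarrow> 'v" where
  "horizontal_lift A \<omega> p = inv_into (horizontal A \<omega> p) (anchor A p)"

definition induced_form ::
  "('m, 'v, 'f, 'e::real_inner) lie_algebroid \<Rightarrow> ('m \<Rightarrow> 'v \<Rightarrow> 'v \<Rightarrow> real) \<Rightarrow>
   ('m \<Rightarrow> 'v \<Rightarrow> 'v \<Rightarrow> real) \<Rightarrow> 'm \<Rightarrow> 'e \<Rightarrow> 'e \<Rightarrow> real" where
  "induced_form A \<omega> \<beta> p x y = \<beta> p (horizontal_lift A \<omega> p x) (horizontal_lift A \<omega> p y)"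

definition induced_complex ::
  "('m, 'v, 'f, 'e::real_inner) lie_algebroid \<Rightarrow> ('m \<Rightarrow> 'v \<Rightarrow> 'v \<Rightarrow> real) \<Rightarrow>
   ('m \<Rightarrow> 'v \<Rightarrow> 'v) \<Rightarrow> 'm \<Rightarrow> 'e \<Rightarrow> 'e" where
  "induced_complex A \<omega> J p x = anchor A p (J p (horizontal_lift A \<omega> p x))"

definition nijenhuis ::
  "('m, 'v::real_vector, 'f, 'e) lie_algebroid \<Rightarrow> ('m \<Rightarrow> 'v \<Rightarrow> 'v) \<Rightarrow>
   ('m \<Rightarrow> 'v) \<Rightarrow> ('m \<Rightarrow> 'v) \<Rightarrow> 'm \<Rightarrow> 'v" where
  "nijenhuis A J S T p =
     (let JS = (\<lambda>q. J q (S q)); JT = (\<lambda>q. J q (T q))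
      in bracket A JS JT p - bracket A S T p - J p (bracket A JS T p) - J p (bracket A S JT p))"

definition kahler ::
  "('m::{t2_space,second_countable_topology}, 'e::real_inner) chart set \<Rightarrow>
   ('m, 'v::real_vector, 'f::real_inner, 'e) lie_algebroid \<Rightarrow>
   ('m \<Rightarrow> 'v \<Rightarrow> 'v \<Rightarrow> real) \<Rightarrow> ('m \<Rightarrow> 'v \<Rightarrow> 'v) \<Rightarrow> ('m \<Rightarrow> 'v \<Rightarrow> 'v \<Rightarrow> real) \<Rightarrow> bool" where
  "kahler M A \<omega> J g \<longleftrightarrow>
     lie_algebroid M A \<and> compatible_triple M A \<omega> J g \<and>
     (\<forall>S\<in>sections M A. \<forall>T\<in>sections M A. \<forall>p. nijenhuis A J S T p = 0)"

end

theory Submission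
  imports Defs
begin

text \<open>
  On sections of \<open>L\<close>, closedness of \<open>\<omega>\<close> and invariance of \<open>g\<close> say that \<open>J\<close> is a derivation of
  the bracket, and \<open>J\<^sup>2 = -1\<close> then forces the bracket to vanish.

  Write \<open>\<lambda>\<close> for the horizontal lift \<open>TM \<rightarrow> E\<close>, where \<open>E\<close> is also the \<open>g\<close>-orthogonal complement
  of \<open>L\<close>.  Closedness of \<open>\<omega>\<close> on \<open>(E, E, L)\<close> gives \<open>[E, E] \<subseteq> E\<close>, so that
  \<open>[\<lambda>X, \<lambda>Y] = \<lambda>[X, Y]\<close> and \<open>N\<^sub>J(\<lambda>X, \<lambda>Y)\<close> is the lift of the Nijenhuis tensor of the base.
  Closedness on \<open>(E, L, L)\<close> together with \<open>\<nabla>g = 0\<close> makes \<open>[a, \<cdot>]\<close> commute with \<open>J\<close> on \<open>L\<close>, so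
  \<open>N\<^sub>J(a, T) = 0\<close> for \<open>T\<close> in \<open>L\<close>.  Hence the two Nijenhuis tensors vanish together.
\<close>

section \<open>Calculus of smooth functions\<close>

text \<open>Every test is made with global sections, and none of them comes from extending a vector
  at a point: a section of L is shown to vanish by pairing it with itself, or with its image under
  J, so positivity of g takes the place of bump functions. For the same reason a section is split
  globally into the lift of its anchor and a section of L, and additivity of the Nijenhuis tensor is
  enough to discard the second part. The analytic obstacle is smoothness of the lift: lifted vector
  fields must be sections, and \<nabla>g = 0 is available only along splittings. Locally the lift is
  the right inverse of the anchor with values orthogonal to L. It is found by solving linear
  equations with smooth coefficients through Gram-Schmidt with parameters, where the only divisions
  are by values of a positive definite form on a nonzero vector. The first claim feeds the second:
  vanishing of [L, L] extends the commutation of [a, .] with J from horizontal a to all sections a,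
  and the Nijenhuis tensor on (a, T) uses it for both a and Ja.\<close>

lemma Ck_on_cong:
  assumes "open S" "\<And>x. x \<in> S \<Longrightarrow> f x = g x" "Ck_on k S f"
  shows "Ck_on k S g"
  using assms(2,3)
proof (induction k arbitrary: f g)
  case 0
  then show ?case by (simp cong: continuous_on_cong)
next
  case (Suc k)
  have g: "(g has_derivative frechet_derivative f (at x)) (at x)" if "x \<in> S" for x
    using Suc.prems that has_derivative_transform_within_open[OF _ assms(1) that, of f _ UNIV g]
    by (auto simp: frechet_derivative_works)
  have "Ck_on k S (\<lambda>x. frechet_derivative g (at x) v)" for v
  proof (rule Suc.IH)
    show "Ck_on k S (\<lambda>x. frechet_derivative f (at x) v)"
      using Suc.prems(2) by simp
    show "frechet_derivative f (at x) v = frechet_derivative g (at x) v" if "x \<in> S" for x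
      using frechet_derivative_at[OF g[OF that]] by simp
  qed
  with g show ?case
    by (auto simp: differentiable_def)
qed

text \<open>Allows an explicit derivative \<open>f'\<close> in place of
  \<open>frechet_derivative\<close>; the closure rules below then only have to recognise
  \<open>f'\<close> along a fixed vector as built from functions of class k.\<close>

lemma Ck_on_SucI:
  assumes "open S" "\<And>x. x \<in> S \<Longrightarrow> (f has_derivative f' x) (at x)"
    and "\<And>v. Ck_on k S (\<lambda>x. f' x v)"
  shows "Ck_on (Suc k) S f"
proof -
  have "Ck_on k S (\<lambda>x. frechet_derivative f (at x) v)" for v
    by (rule Ck_on_cong[OF assms(1) _ assms(3)]) (simp add: frechet_derivative_at[OF assms(2)])
  then show ?thesis
    using assms(2) by (auto simp: differentiable_def)
qed

lemma Ck_on_SucD: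
  assumes "Ck_on (Suc k) S f" "x \<in> S"
  shows "(f has_derivative frechet_derivative f (at x)) (at x)"
  using assms by (simp add: frechet_derivative_works)

lemma Ck_on_subset: "Ck_on k S f \<Longrightarrow> T \<subseteq> S \<Longrightarrow> Ck_on k T f"
  by (induction k arbitrary: f) (auto intro: continuous_on_subset)

lemma Ck_on_lower: "Ck_on (Suc k) S f \<Longrightarrow> Ck_on k S f"
proof (induction k arbitrary: f)
  case 0
  then show ?case
    by (auto intro!: continuous_at_imp_continuous_on differentiable_imp_continuous_within)
next
  case (Suc k)
  then show ?case by auto
qed

lemma Ck_on_local:
  assumes "\<And>x. x \<in> S \<Longrightarrow> \<exists>T. open T \<and> x \<in> T \<and> Ck_on k T f"
  shows "Ck_on k S f"
  using assms
proof (induction k arbitrary: f)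
  case 0
  then show ?case
    by (auto intro!: continuous_at_imp_continuous_on)
      (metis continuous_on_eq_continuous_at)
next
  case (Suc k)
  have "Ck_on k S (\<lambda>x. frechet_derivative f (at x) v)" for v
    by (rule Suc.IH) (use Suc.prems in \<open>simp, blast\<close>)
  moreover have "f differentiable (at x)" if "x \<in> S" for x
    using Suc.prems[OF that] by auto
  ultimately show ?case by simp
qed

lemma Ck_on_const [simp]: "Ck_on k S (\<lambda>x. c)"
  by (induction k arbitrary: c) (auto simp: frechet_derivative_const)

lemma Ck_on_add:
  assumes "open S"
  shows "Ck_on k S f \<Longrightarrow> Ck_on k S g \<Longrightarrow> Ck_on k S (\<lambda>x. f x + g x)"
proof (induction k arbitrary: f g)
  case 0
  then show ?case by (simp add: continuous_on_add)
next
  case (Suc k)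
  show ?case
    using Suc
    by (intro Ck_on_SucI[OF assms has_derivative_add[OF Ck_on_SucD[OF Suc.prems(1)]
          Ck_on_SucD[OF Suc.prems(2)]]]) auto
qed

text \<open>The product rule puts \<open>f\<close> and \<open>g\<close> themselves next to their
  derivatives, so both are first lowered to class k.\<close>

lemma Ck_on_bilinear:
  assumes "bounded_bilinear m" "open S"
  shows "Ck_on k S f \<Longrightarrow> Ck_on k S g \<Longrightarrow> Ck_on k S (\<lambda>x. m (f x) (g x))"
proof (induction k arbitrary: f g)
  case 0
  then show ?case by (simp add: bounded_bilinear.continuous_on[OF assms(1)])
next
  case (Suc k)
  have low: "Ck_on k S f" "Ck_on k S g"
    using Suc.prems by (blast intro: Ck_on_lower)+
  show ?case
    by (intro Ck_on_SucI[OF assms(2) bounded_bilinear.FDERIV[OF assms(1)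
          Ck_on_SucD[OF Suc.prems(1)] Ck_on_SucD[OF Suc.prems(2)]]] Ck_on_add Suc.IH low assms(2))
      (use Suc.prems in auto)
qed

text \<open>The inverse reappears in its own derivative, so the induction hypothesis for the same
  \<open>f\<close> supplies that factor. The sign is written as a factor -1 to stay within closure
  under products.\<close>

lemma Ck_on_inverse:
  fixes f :: "'e::real_inner \<Rightarrow> real"
  assumes "open S" "\<And>x. x \<in> S \<Longrightarrow> f x \<noteq> 0"
  shows "Ck_on k S f \<Longrightarrow> Ck_on k S (\<lambda>x. inverse (f x))"
proof (induction k)
  case 0
  then show ?case using assms(2) by (simp add: continuous_on_inverse)
next
  case (Suc k)
  have i: "Ck_on k S (\<lambda>x. inverse (f x))"
    using Suc Ck_on_lower by blast
  show ?case
  proof (rule Ck_on_SucI[OF assms(1)])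
    show "((\<lambda>x. inverse (f x)) has_derivative
        (\<lambda>h. (- 1) * (inverse (f x) * frechet_derivative f (at x) h * inverse (f x)))) (at x)"
      if "x \<in> S" for x
      using Deriv.has_derivative_inverse[OF assms(2)[OF that] Ck_on_SucD[OF Suc.prems that]]
      by simp
    show "Ck_on k S (\<lambda>x. (- 1) * (inverse (f x) * frechet_derivative f (at x) v * inverse (f x)))" for v
      using Suc.prems
      by (intro Ck_on_bilinear[OF bounded_bilinear_mult assms(1)] i Ck_on_const) auto
  qed
qed

lemma Ck_on_sum:
  assumes "open S"
  shows "(\<And>i. i \<in> I \<Longrightarrow> Ck_on k S (f i)) \<Longrightarrow> Ck_on k S (\<lambda>x. \<Sum>i\<in>I. f i x)"
  by (induction I rule: infinite_finite_induct) (auto intro!: Ck_on_add[OF assms])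

section \<open>Orthonormal bases and the chain rule\<close>

text \<open>Gram-Schmidt, because \<open>finite_dim\<close> provides no more than some finite
  spanning set.\<close>

lemma orthonormal_extension:
  assumes "finite (B::'e::real_inner set)"
  shows "\<exists>C. finite C \<and> (\<forall>x\<in>C. \<forall>y\<in>C. x \<bullet> y = (if x = y then 1 else 0)) \<and> span C = span B"
  using assms
proof induction
  case empty
  show ?case by (intro exI[of _ "{}"]) simp
next
  case (insert b B)
  then obtain C where C: "finite C" "\<And>x y. x \<in> C \<Longrightarrow> y \<in> C \<Longrightarrow> x \<bullet> y = (if x = y then 1 else 0)"
    "span C = span B" by blast
  define q where "q = (\<Sum>c\<in>C. (b \<bullet> c) *\<^sub>R c)"
  define a where "a = b - q"
  have q: "q \<in> span C" unfolding q_def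
    by (intro span_sum span_scale span_base)
  have perp: "a \<bullet> c = 0" if "c \<in> C" for c
  proof -
    have "q \<bullet> c = (\<Sum>d\<in>C. if d = c then b \<bullet> c else 0)"
      unfolding q_def inner_sum_left by (rule sum.cong) (use C(2) that in auto)
    then show ?thesis
      using C(1) that by (simp add: a_def inner_diff_left)
  qed
  have span: "span (insert a C) = span (insert b B)"
  proof -
    have "a \<in> span (insert b C)"
      unfolding a_def using q by (meson insertI1 span_base span_diff span_mono subset_insertI subsetD)
    moreover have "b \<in> span (insert a C)"
    proof -
      have "b = a + q" by (simp add: a_def)
      then show ?thesis
        using q by (metis insertI1 span_add span_base span_mono subset_insertI subsetD)
    qed
    ultimately have "span (insert a C) = span (insert b C)"
      by (auto simp: span_eq intro: span_base)
    also have "\<dots> = span (insert b B)"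
      using C(3) by (simp add: span_insert)
    finally show ?thesis .
  qed
  show ?case
  \<comment> \<open>The spanning set may be dependent; a zero remainder means that \<open>b\<close>
    adds nothing to the span.\<close>
  proof (cases "a = 0")
    case True
    then show ?thesis
      using C span by (intro exI[of _ C]) (auto simp: span_insert_0)
  next
    case False
    define n where "n = a /\<^sub>R norm a"
    have nn: "n \<bullet> n = 1"
      using False by (simp add: n_def dot_square_norm power2_eq_square)
    have nc: "n \<bullet> c = 0" "c \<bullet> n = 0" if "c \<in> C" for c
      using perp[OF that] by (simp_all add: n_def inner_commute)
    have "n \<notin> C" using nn nc(1) by force
    have an: "a = norm a *\<^sub>R n" using False by (simp add: n_def)
    have "span (insert n C) = span (insert a C)"
    proof -
      have "n \<in> span (insert a C)" unfolding n_def by (intro span_scale span_base) simp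
      moreover have "a \<in> span (insert n C)" by (subst an, intro span_scale span_base) simp
      ultimately show ?thesis by (auto simp: span_eq intro: span_base)
    qed
    then show ?thesis
      using C nn nc span \<open>n \<notin> C\<close> by (intro exI[of _ "insert n C"]) auto
  qed
qed

lemma finite_dim_expansion:
  assumes "finite_dim TYPE('e::real_inner)"
  obtains B where "finite B" "\<And>x::'e. x = (\<Sum>b\<in>B. (x \<bullet> b) *\<^sub>R b)"
proof -
  obtain B0 :: "'e set" where "finite B0" "span B0 = UNIV"
    using assms unfolding finite_dim_def by blast
  then obtain B :: "'e set" where B: "finite B" "span B = UNIV"
    "\<And>x y. x \<in> B \<Longrightarrow> y \<in> B \<Longrightarrow> x \<bullet> y = (if x = y then 1 else 0)"
    using orthonormal_extension[of B0] by auto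
  have "x = (\<Sum>b\<in>B. (x \<bullet> b) *\<^sub>R b)" for x
  proof -
    have "x \<in> span B" using B(2) by simp
    then show ?thesis
    proof (induction rule: span_induct_alt)
      case base
      then show ?case by simp
    next
      case (step r c y)
      have "(\<Sum>b\<in>B. (c \<bullet> b) *\<^sub>R b) = (\<Sum>b\<in>B. if b = c then c else 0)"
        by (rule sum.cong) (use B(3) step(1) in auto)
      also have "\<dots> = c" using B(1) step(1) by simp
      finally have c: "(\<Sum>b\<in>B. (c \<bullet> b) *\<^sub>R b) = c" .
      have "(\<Sum>b\<in>B. ((r *\<^sub>R c + y) \<bullet> b) *\<^sub>R b) = r *\<^sub>R (\<Sum>b\<in>B. (c \<bullet> b) *\<^sub>R b) + (\<Sum>b\<in>B. (y \<bullet> b) *\<^sub>R b)"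
        by (simp add: inner_add_left scaleR_add_left sum.distrib scaleR_sum_right)
      then show ?case using step.IH c by simp
    qed
  qed
  then show ?thesis using that B(1) by blast
qed

lemma linear_expansion:
  assumes "finite B" "\<And>x::'e::real_inner. x = (\<Sum>b\<in>B. (x \<bullet> b) *\<^sub>R b)" "linear h"
  shows "h x = (\<Sum>b\<in>B. (x \<bullet> b) *\<^sub>R h b)"
proof -
  interpret linear h by fact
  have "h x = h (\<Sum>b\<in>B. (x \<bullet> b) *\<^sub>R b)" using assms(2) by metis
  then show ?thesis by (simp add: sum scale)
qed

text \<open>By the chain rule \<open>g\<close> is differentiated in a direction that moves with x,
  whereas \<open>Ck_on\<close> speaks of fixed directions only. Expanding the direction in a basis
  of the intermediate space gives a finite sum of products; this is where finite dimension
  enters.\<close>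

lemma Ck_on_compose:
  fixes f :: "'d::real_inner \<Rightarrow> 'e::real_inner"
  assumes "finite_dim TYPE('e)" "open S" "f ` S \<subseteq> T"
  shows "Ck_on k S f \<Longrightarrow> Ck_on k T g \<Longrightarrow> Ck_on k S (g \<circ> f)"
proof (induction k arbitrary: g)
  case 0
  then show ?case
    using assms(3) by (metis Ck_on.simps(1) continuous_on_compose continuous_on_subset)
next
  case (Suc k)
  obtain B where B: "finite B" "\<And>x::'e. x = (\<Sum>b\<in>B. (x \<bullet> b) *\<^sub>R b)"
    using finite_dim_expansion[OF assms(1)] by blast
  show ?case
  proof (rule Ck_on_SucI[OF assms(2)])
    show "(g \<circ> f has_derivative (\<lambda>v. \<Sum>b\<in>B. (frechet_derivative f (at x) v \<bullet> b) *\<^sub>R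
        frechet_derivative g (at (f x)) b)) (at x)" if "x \<in> S" for x
    proof -
      have g: "(g has_derivative frechet_derivative g (at (f x))) (at (f x))"
        using Ck_on_SucD[OF Suc.prems(2)] that assms(3) by auto
      have "(g \<circ> f has_derivative frechet_derivative g (at (f x)) \<circ> frechet_derivative f (at x)) (at x)"
        by (rule diff_chain_at[OF Ck_on_SucD[OF Suc.prems(1) that] g])
      also have "frechet_derivative g (at (f x)) \<circ> frechet_derivative f (at x) =
          (\<lambda>v. \<Sum>b\<in>B. (frechet_derivative f (at x) v \<bullet> b) *\<^sub>R frechet_derivative g (at (f x)) b)"
        by (rule ext, unfold comp_def, rule linear_expansion[OF B has_derivative_linear[OF g]])
      finally show ?thesis .
    qed
    have f: "Ck_on k S f" using Suc.prems(1) by (rule Ck_on_lower)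
    show "Ck_on k S (\<lambda>x. \<Sum>b\<in>B. (frechet_derivative f (at x) v \<bullet> b) *\<^sub>R
        frechet_derivative g (at (f x)) b)" for v
    proof (intro Ck_on_sum[OF assms(2)] Ck_on_bilinear[OF bounded_bilinear_scaleR assms(2)]
        Ck_on_bilinear[OF bounded_bilinear_inner assms(2)] Ck_on_const)
      show "Ck_on k S (\<lambda>x. frechet_derivative f (at x) v)"
        using Suc.prems(1) by simp
      show "Ck_on k S (\<lambda>x. frechet_derivative g (at (f x)) b)" for b
        using Suc.IH[OF f, of "\<lambda>y. frechet_derivative g (at y) b"] Suc.prems(2)
        by (simp add: o_def)
    qed
  qed
qed

section \<open>Smooth functions on manifolds\<close>

locale manifold =
  fixes M :: "('m::{t2_space,second_countable_topology}, 'e::real_inner) chart set"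
  assumes manifold: "smooth_manifold M"
begin

lemma is_chart: "c \<in> M \<Longrightarrow> is_chart c"
  and finite_dim_model: "finite_dim TYPE('e)"
  and charts_cover: "\<exists>c\<in>M. p \<in> fst c"
  and transition_smooth:
    "c \<in> M \<Longrightarrow> d \<in> M \<Longrightarrow> smooth_on (snd c ` (fst c \<inter> fst d)) (snd d \<circ> chart_inv c)"
  using manifold unfolding smooth_manifold_def by blast+

lemma chart_at: "chart_at M p \<in> M" "p \<in> fst (chart_at M p)"
proof -
  have "\<exists>c. c \<in> M \<and> p \<in> fst c" using charts_cover by blast
  from someI_ex[OF this] show "chart_at M p \<in> M" "p \<in> fst (chart_at M p)"
    unfolding chart_at_def by simp_all
qed

lemma open_chart: "c \<in> M \<Longrightarrow> open (fst c)"
  using is_chart unfolding is_chart_def by blast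

lemma chart_inv_left [simp]: "c \<in> M \<Longrightarrow> p \<in> fst c \<Longrightarrow> chart_inv c (snd c p) = p"
  using is_chart unfolding is_chart_def homeomorphism_def by blast

lemma open_chart_image:
  assumes "c \<in> M" "open W"
  shows "open (snd c ` (fst c \<inter> W))"
proof -
  have "openin (top_of_set (snd c ` fst c)) (snd c ` (fst c \<inter> W))"
    using is_chart[OF assms(1)] homeomorphism_imp_open_map[of "fst c" "snd c ` fst c" "snd c"
        "chart_inv c" "fst c \<inter> W"] assms(2) unfolding is_chart_def by blast
  then show ?thesis
    using is_chart[OF assms(1)] openin_open_trans unfolding is_chart_def by blast
qed

lemma smooth_map_onI:
  assumes "\<And>c k. c \<in> M \<Longrightarrow> Ck_on k (snd c ` (fst c \<inter> W)) (\<lambda>x. f (chart_inv c x))"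
  shows "smooth_map_on M W f"
  using assms unfolding smooth_map_on_def smooth_on_def comp_def by blast

lemma smooth_map_onD:
  assumes "smooth_map_on M W f" "c \<in> M"
  shows "Ck_on k (snd c ` (fst c \<inter> W)) (\<lambda>x. f (chart_inv c x))"
  using assms unfolding smooth_map_on_def smooth_on_def comp_def by blast

lemma smooth_map_on_cong:
  assumes "open W" "\<And>p. p \<in> W \<Longrightarrow> f p = g p" "smooth_map_on M W f"
  shows "smooth_map_on M W g"
proof (rule smooth_map_onI)
  fix c k assume c: "c \<in> M"
  show "Ck_on k (snd c ` (fst c \<inter> W)) (\<lambda>x. g (chart_inv c x))"
    by (rule Ck_on_cong[OF open_chart_image[OF c assms(1)] _ smooth_map_onD[OF assms(3) c]])
      (use assms(2) c in auto)
qed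

lemma smooth_map_on_subset:
  assumes "smooth_map_on M W f" "V \<subseteq> W"
  shows "smooth_map_on M V f"
  by (intro smooth_map_onI Ck_on_subset[OF smooth_map_onD[OF assms(1)]]) (use assms(2) in auto)

lemma smooth_map_on_local:
  assumes "\<And>p. p \<in> W \<Longrightarrow> \<exists>V. open V \<and> p \<in> V \<and> smooth_map_on M V f"
  shows "smooth_map_on M W f"
proof (intro smooth_map_onI Ck_on_local)
  fix c k x assume c: "c \<in> M" and "x \<in> snd c ` (fst c \<inter> W)"
  then obtain p where p: "p \<in> fst c" "p \<in> W" "x = snd c p" by blast
  then obtain V where V: "open V" "p \<in> V" "smooth_map_on M V f" using assms by blast
  show "\<exists>T. open T \<and> x \<in> T \<and> Ck_on k T (\<lambda>x. f (chart_inv c x))"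
    using open_chart_image[OF c V(1)] V(2) p smooth_map_onD[OF V(3) c, of k] by blast
qed

lemma smooth_map_on_const: "smooth_map_on M W (\<lambda>p. c)"
  by (intro smooth_map_onI) simp

lemma smooth_map_on_add:
  assumes "open W" "smooth_map_on M W f" "smooth_map_on M W g"
  shows "smooth_map_on M W (\<lambda>p. f p + g p)"
  by (intro smooth_map_onI Ck_on_add open_chart_image smooth_map_onD[OF assms(2)]
      smooth_map_onD[OF assms(3)] assms(1))

lemma smooth_map_on_sum:
  assumes "open W" "\<And>i. i \<in> I \<Longrightarrow> smooth_map_on M W (f i)"
  shows "smooth_map_on M W (\<lambda>p. \<Sum>i\<in>I. f i p)"
  by (intro smooth_map_onI Ck_on_sum open_chart_image smooth_map_onD[OF assms(2)] assms(1))

lemma smooth_map_on_bilinear: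
  assumes "bounded_bilinear m" "open W" "smooth_map_on M W f" "smooth_map_on M W g"
  shows "smooth_map_on M W (\<lambda>p. m (f p) (g p))"
  by (intro smooth_map_onI Ck_on_bilinear[OF assms(1)] open_chart_image smooth_map_onD[OF assms(3)]
      smooth_map_onD[OF assms(4)] assms(2))

lemmas smooth_map_on_scaleR = smooth_map_on_bilinear[OF bounded_bilinear_scaleR]
  and smooth_map_on_mult = smooth_map_on_bilinear[OF bounded_bilinear_mult]
  and smooth_map_on_inner = smooth_map_on_bilinear[OF bounded_bilinear_inner]

lemma smooth_map_on_inverse:
  fixes f :: "'m \<Rightarrow> real"
  assumes "open W" "smooth_map_on M W f" "\<And>p. p \<in> W \<Longrightarrow> f p \<noteq> 0"
  shows "smooth_map_on M W (\<lambda>p. inverse (f p))"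
proof (intro smooth_map_onI Ck_on_inverse open_chart_image smooth_map_onD[OF assms(2)] assms(1))
  show "f (chart_inv c x) \<noteq> 0" if "c \<in> M" "x \<in> snd c ` (fst c \<inter> W)" for c x
    using that assms(3) by auto
qed auto

section \<open>Smooth families of linear maps and smooth solutions of linear equations\<close>

text \<open>Bundle maps and forms are declared smooth by their values on constant coordinate
  vectors. Expanding the argument in a basis passes from these to arguments that vary
  smoothly.\<close>

lemma smooth_map_on_apply:
  fixes h :: "'m \<Rightarrow> 'f::real_inner \<Rightarrow> 'g::real_normed_vector"
  assumes "finite_dim TYPE('f)" "open W" "\<And>p. p \<in> W \<Longrightarrow> linear (h p)"
    and "\<And>x. smooth_map_on M W (\<lambda>p. h p x)" "smooth_map_on M W f"
  shows "smooth_map_on M W (\<lambda>p. h p (f p))"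
proof -
  obtain B where B: "finite B" "\<And>x::'f. x = (\<Sum>b\<in>B. (x \<bullet> b) *\<^sub>R b)"
    using finite_dim_expansion[OF assms(1)] by blast
  show ?thesis
  proof (rule smooth_map_on_cong[OF assms(2)])
    show "(\<Sum>b\<in>B. (f p \<bullet> b) *\<^sub>R h p b) = h p (f p)" if "p \<in> W" for p
      using linear_expansion[OF B assms(3)[OF that]] by metis
    show "smooth_map_on M W (\<lambda>p. \<Sum>b\<in>B. (f p \<bullet> b) *\<^sub>R h p b)"
      by (intro smooth_map_on_sum smooth_map_on_scaleR smooth_map_on_inner smooth_map_on_const
          assms(2,4,5))
  qed
qed

lemma smooth_map_on_apply2:
  fixes H :: "'m \<Rightarrow> 'f::real_inner \<Rightarrow> 'f \<Rightarrow> real"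
  assumes "finite_dim TYPE('f)" "open W" "\<And>p. p \<in> W \<Longrightarrow> bilinear (H p)"
    and "\<And>x y. smooth_map_on M W (\<lambda>p. H p x y)" "smooth_map_on M W f" "smooth_map_on M W g"
  shows "smooth_map_on M W (\<lambda>p. H p (f p) (g p))"
proof (rule smooth_map_on_apply[OF assms(1,2) _ _ assms(6)])
  show "linear (H p (f p))" if "p \<in> W" for p
    using assms(3)[OF that] unfolding bilinear_def by blast
  show "smooth_map_on M W (\<lambda>p. H p (f p) x)" for x
    by (rule smooth_map_on_apply[OF assms(1,2) _ _ assms(5)])
      (use assms(3,4) in \<open>auto simp: bilinear_def\<close>)
qed

text \<open>Gram--Schmidt with parameters: the representing vector on the span of one more vector \<open>b\<close>
  is corrected along the component \<open>w\<close> of \<open>b\<close> orthogonal to the previous span.\<close>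

lemma smooth_riesz_span:
  fixes H :: "'m \<Rightarrow> 'f::real_inner \<Rightarrow> 'f \<Rightarrow> real"
  assumes fd: "finite_dim TYPE('f)" and W: "open W"
    and bil: "\<And>p. p \<in> W \<Longrightarrow> bilinear (H p)"
    and sym: "\<And>p x y. p \<in> W \<Longrightarrow> H p x y = H p y x"
    and pos: "\<And>p x. p \<in> W \<Longrightarrow> x \<noteq> 0 \<Longrightarrow> H p x x > 0"
    and sm: "\<And>x y. smooth_map_on M W (\<lambda>p. H p x y)"
    and B: "finite B" "independent B"
    and phi: "\<And>p. p \<in> W \<Longrightarrow> linear (\<phi> p)" "\<And>x. smooth_map_on M W (\<lambda>p. \<phi> p x)"
  shows "\<exists>r. smooth_map_on M W r \<and> (\<forall>p\<in>W. r p \<in> span B \<and> (\<forall>x\<in>span B. H p (r p) x = \<phi> p x))"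
  using B phi
proof (induction arbitrary: \<phi>)
  case empty
  show ?case
  proof (intro exI[of _ "\<lambda>p. 0"] conjI ballI)
    show "smooth_map_on M W (\<lambda>p. 0::'f)" by (rule smooth_map_on_const)
  qed (use empty.prems(2) bil linear_0 in \<open>auto simp: bilinear_lzero\<close>)
next
  case (insert b B)
  have B: "independent B" and bB: "b \<notin> span B"
    using insert.prems(1) insert.hyps by (auto simp: independent_insert)
  have "\<And>p. p \<in> W \<Longrightarrow> linear (H p b)" using bil unfolding bilinear_def by blast
  \<comment> \<open>The hypothesis is used twice: for the functional H(b, .) it gives the projection
    \<open>q\<close> of \<open>b\<close> to the old span, and for \<phi> the solution
    \<open>s\<close> there.\<close>
  from insert.IH[OF B this sm] obtain q where q: "smooth_map_on M W q"
    "\<And>p. p \<in> W \<Longrightarrow> q p \<in> span B" "\<And>p x. p \<in> W \<Longrightarrow> x \<in> span B \<Longrightarrow> H p (q p) x = H p b x"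
    by blast
  from insert.IH[OF B insert.prems(2,3)] obtain s where s: "smooth_map_on M W s"
    "\<And>p. p \<in> W \<Longrightarrow> s p \<in> span B" "\<And>p x. p \<in> W \<Longrightarrow> x \<in> span B \<Longrightarrow> H p (s p) x = \<phi> p x"
    by blast
  define w where "w = (\<lambda>p. b + (- 1) *\<^sub>R q p)"
  have w_smooth: "smooth_map_on M W w"
    unfolding w_def by (intro smooth_map_on_add smooth_map_on_scaleR smooth_map_on_const W q)
  have w_perp: "H p (w p) x = 0" "H p x (w p) = 0" if "p \<in> W" "x \<in> span B" for p x
  proof -
    show "H p (w p) x = 0"
      using q(3)[OF that] bil[OF that(1)] by (simp add: w_def bilinear_lsub)
    then show "H p x (w p) = 0" using sym[OF that(1)] by simp
  qed
  have w_pos: "H p (w p) (w p) > 0" if "p \<in> W" for p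
  proof (rule pos[OF that])
    show "w p \<noteq> 0" using q(2)[OF that] bB by (auto simp: w_def)
  qed
  \<comment> \<open>\<open>t\<close> is forced by H(r, w) = \<phi>(w), because \<open>s\<close> lies
    in the old span and so is orthogonal to \<open>w\<close>.\<close>
  define t where "t = (\<lambda>p. \<phi> p (w p) * inverse (H p (w p) (w p)))"
  have t: "t p * H p (w p) (w p) = \<phi> p (w p)" if "p \<in> W" for p
    using w_pos[OF that] by (simp add: t_def)
  have t_smooth: "smooth_map_on M W t"
    unfolding t_def using w_pos
    by (intro smooth_map_on_mult smooth_map_on_inverse W smooth_map_on_apply2[OF fd W bil sm]
        smooth_map_on_apply[OF fd W insert.prems(2,3)] w_smooth) force+
  define r where "r = (\<lambda>p. s p + t p *\<^sub>R w p)"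
  have r_smooth: "smooth_map_on M W r"
    unfolding r_def by (intro smooth_map_on_add smooth_map_on_scaleR W s t_smooth w_smooth)
  have sub: "span B \<subseteq> span (insert b B)" by (intro span_mono) auto
  have w_span: "w p \<in> span (insert b B)" if "p \<in> W" for p
    unfolding w_def using q(2)[OF that] sub
    by (intro span_add span_scale) (auto intro: span_base)
  have "r p \<in> span (insert b B)" if "p \<in> W" for p
    unfolding r_def using s(2)[OF that] sub w_span[OF that] by (intro span_add span_scale) auto
  moreover have "H p (r p) x = \<phi> p x" if p: "p \<in> W" and x: "x \<in> span (insert b B)" for p x
  proof -
    obtain k where k: "x - k *\<^sub>R b \<in> span B" using x by (auto simp: span_insert)
    \<comment> \<open>Splitting off a multiple of \<open>w\<close> instead of \<open>b\<close> makes
      the two parts of \<open>x\<close> orthogonal.\<close>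
    define y where "y = x - k *\<^sub>R w p"
    have "y = (x - k *\<^sub>R b) + k *\<^sub>R q p" by (simp add: y_def w_def algebra_simps)
    then have y: "y \<in> span B" using k q(2)[OF p] by (metis span_add span_scale)
    have x_eq: "x = y + k *\<^sub>R w p" by (simp add: y_def)
    note b = bil[OF p] and l = insert.prems(2)[OF p]
    have "H p (r p) x = \<phi> p y + k * (t p * H p (w p) (w p))"
      unfolding x_eq r_def
      by (simp add: bilinear_ladd[OF b] bilinear_radd[OF b] bilinear_lmul[OF b] bilinear_rmul[OF b]
          w_perp[OF p y] w_perp[OF p s(2)[OF p]] s(3)[OF p y])
    also have "\<dots> = \<phi> p x"
      unfolding x_eq t[OF p] using l by (simp add: linear_add linear_scale)
    finally show ?thesis .
  qed
  ultimately show ?case using r_smooth by blast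
qed

text \<open>Serves as the smooth inversion of a Gram matrix.\<close>

lemma smooth_riesz:
  fixes H :: "'m \<Rightarrow> 'f::real_inner \<Rightarrow> 'f \<Rightarrow> real"
  assumes fd: "finite_dim TYPE('f)" and W: "open W"
    and bil: "\<And>p. p \<in> W \<Longrightarrow> bilinear (H p)"
    and sym: "\<And>p x y. p \<in> W \<Longrightarrow> H p x y = H p y x"
    and pos: "\<And>p x. p \<in> W \<Longrightarrow> x \<noteq> 0 \<Longrightarrow> H p x x > 0"
    and sm: "\<And>x y. smooth_map_on M W (\<lambda>p. H p x y)"
    and phi: "\<And>p. p \<in> W \<Longrightarrow> linear (\<phi> p)" "\<And>x. smooth_map_on M W (\<lambda>p. \<phi> p x)"
  obtains r where "smooth_map_on M W r" "\<And>p x. p \<in> W \<Longrightarrow> H p (r p) x = \<phi> p x"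
proof -
  obtain B0 :: "'f set" where B0: "finite B0" "span B0 = UNIV"
    using fd unfolding finite_dim_def by blast
  obtain B where B: "B \<subseteq> B0" "independent B" "B0 \<subseteq> span B"
    using maximal_independent_subset[of B0] by metis
  have "finite B" using B(1) B0(1) finite_subset by blast
  moreover have "span B = UNIV"
    using B(3) B0(2) by (metis span_mono span_span top.extremum_unique)
  ultimately show ?thesis
    using smooth_riesz_span[OF fd W bil sym pos sm _ B(2) phi] that by (metis UNIV_I)
qed

text \<open>The right inverse is \<open>R\<^sup>* (R R\<^sup>*)\<^sup>-\<^sup>1\<close>, where \<open>R\<^sup>*\<close> is the adjoint for \<open>G\<close> on \<open>'f\<close> and
  the standard inner product on \<open>'d\<close>.\<close>

lemma smooth_right_inverse:
  fixes G :: "'m \<Rightarrow> 'f::real_inner \<Rightarrow> 'f \<Rightarrow> real" and R :: "'m \<Rightarrow> 'f \<Rightarrow> 'd::real_inner"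
  assumes fdf: "finite_dim TYPE('f)" and fdd: "finite_dim TYPE('d)" and W: "open W"
    and bil: "\<And>p. p \<in> W \<Longrightarrow> bilinear (G p)"
    and sym: "\<And>p x y. p \<in> W \<Longrightarrow> G p x y = G p y x"
    and pos: "\<And>p x. p \<in> W \<Longrightarrow> x \<noteq> 0 \<Longrightarrow> G p x x > 0"
    and sm: "\<And>x y. smooth_map_on M W (\<lambda>p. G p x y)"
    and R: "\<And>p. p \<in> W \<Longrightarrow> linear (R p)" "\<And>p. p \<in> W \<Longrightarrow> surj (R p)"
      "\<And>x. smooth_map_on M W (\<lambda>p. R p x)"
  obtains l where "smooth_map_on M W l" "\<And>p. p \<in> W \<Longrightarrow> R p (l p) = x"
    "\<And>p y. p \<in> W \<Longrightarrow> R p y = 0 \<Longrightarrow> G p (l p) y = 0"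
proof -
  \<comment> \<open>\<open>r\<close> is the adjoint R* applied to \<xi>.\<close>
  have "\<exists>r. smooth_map_on M W r \<and> (\<forall>p\<in>W. \<forall>y. G p (r p) y = \<xi> \<bullet> R p y)" for \<xi>
  proof -
    have lin: "linear (\<lambda>y. \<xi> \<bullet> R p y)" if "p \<in> W" for p
      using R(1)[OF that] by (intro linearI) (simp_all add: linear_add linear_scale inner_add_right)
    have "smooth_map_on M W (\<lambda>p. \<xi> \<bullet> R p y)" for y
      by (intro smooth_map_on_inner smooth_map_on_const W R)
    with lin show ?thesis using smooth_riesz[OF fdf W bil sym pos sm, of "\<lambda>p y. \<xi> \<bullet> R p y"] by metis
  qed
  then obtain P where P: "\<And>\<xi>. smooth_map_on M W (P \<xi>)"
    "\<And>\<xi> p y. p \<in> W \<Longrightarrow> G p (P \<xi> p) y = \<xi> \<bullet> R p y" by metis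
  have inj: "u = v" if p: "p \<in> W" and eq: "\<And>y. G p u y = G p v y" for p u v
  proof (rule ccontr)
    assume "u \<noteq> v"
    then have "G p (u - v) (u - v) > 0" using pos[OF p] by simp
    then show False using eq bil[OF p] by (simp add: bilinear_lsub)
  qed
  have Plin: "linear (\<lambda>\<xi>. P \<xi> p)" if p: "p \<in> W" for p
    by (intro linearI; rule inj[OF p])
      (simp_all add: bilinear_ladd[OF bil[OF p]] bilinear_lmul[OF bil[OF p]] P(2)[OF p] inner_add_left)
  \<comment> \<open>The quadratic form of the operator R R*; a second use of
    \<open>smooth_riesz\<close>, now on \<open>'d\<close>, inverts it.\<close>
  define H where "H = (\<lambda>p \<xi> \<eta>. G p (P \<xi> p) (P \<eta> p))"
  have H: "H p \<xi> \<eta> = \<xi> \<bullet> R p (P \<eta> p)" if "p \<in> W" for p \<xi> \<eta>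
    using P(2)[OF that] by (simp add: H_def)
  have H_bil: "bilinear (H p)" if p: "p \<in> W" for p
    unfolding bilinear_def H_def using bil[OF p]
    by (intro conjI allI linearI)
      (simp_all add: linear_add[OF Plin[OF p]] linear_scale[OF Plin[OF p]] bilinear_ladd
        bilinear_lmul bilinear_radd bilinear_rmul)
  have H_sym: "H p x y = H p y x" if p: "p \<in> W" for p x y
    unfolding H_def using sym[OF p] .
  \<comment> \<open>Definiteness of \<open>H\<close> is injectivity of R*, so it rests on
    surjectivity of R.\<close>
  have H_pos: "H p x x > 0" if p: "p \<in> W" and x: "x \<noteq> 0" for p x
    unfolding H_def
  proof (rule pos[OF p], rule)
    assume "P x p = 0"
    then have "x \<bullet> R p y = 0" for y using P(2)[OF p, of x y] bil[OF p] by (simp add: bilinear_lzero)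
    then have "x \<bullet> x = 0" using R(2)[OF p] by (metis surjD)
    with x show False by simp
  qed
  have H_sm: "smooth_map_on M W (\<lambda>p. H p x y)" for x y
    unfolding H_def by (rule smooth_map_on_apply2[OF fdf W bil sm P(1) P(1)])
  have lin: "linear (\<lambda>v::'d. x \<bullet> v)" for x
    by (intro linearI) (simp_all add: inner_add_right)
  obtain \<eta> where \<eta>: "smooth_map_on M W \<eta>" "\<And>p v. p \<in> W \<Longrightarrow> H p (\<eta> p) v = x \<bullet> v"
    using smooth_riesz[OF fdd W H_bil H_sym H_pos H_sm, of "\<lambda>p v. x \<bullet> v"] lin smooth_map_on_const
    by metis
  show ?thesis
  proof (rule that[of "\<lambda>p. P (\<eta> p) p"])
    show "smooth_map_on M W (\<lambda>p. P (\<eta> p) p)"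
      by (rule smooth_map_on_apply[OF fdd W Plin P(1) \<eta>(1)])
    show "R p (P (\<eta> p) p) = x" if p: "p \<in> W" for p
    proof -
      have "v \<bullet> R p (P (\<eta> p) p) = v \<bullet> x" for v
        using H[OF p] H_sym[OF p] \<eta>(2)[OF p] by (metis inner_commute)
      then show ?thesis using vector_eq_ldot by blast
    qed
    \<comment> \<open>The range of R* is orthogonal to the kernel of R; with R the anchor this makes
      the solution horizontal.\<close>
    show "G p (P (\<eta> p) p) y = 0" if "p \<in> W" "R p y = 0" for p y
      using P(2) that by simp
  qed
qed

section \<open>Vector bundles and their sections\<close>

lemma
  assumes "vector_bundle M (E :: ('m, 'v::real_vector, 'f::real_inner, 'z) vbundle_scheme)"
  shows finite_dim_fibre: "finite_dim TYPE('f)"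
    and subspace_fibre: "subspace (fibre E p)"
    and open_triv: "(U, \<Phi>) \<in> trivs E \<Longrightarrow> open U"
    and triv_linear: "(U, \<Phi>) \<in> trivs E \<Longrightarrow> p \<in> U \<Longrightarrow> linear_between (fibre E p) UNIV (\<Phi> p)"
    and triv_bij: "(U, \<Phi>) \<in> trivs E \<Longrightarrow> p \<in> U \<Longrightarrow> bij_betw (\<Phi> p) (fibre E p) UNIV"
    and trivs_cover: "\<exists>U \<Phi>. (U, \<Phi>) \<in> trivs E \<and> p \<in> U"
proof -
  note v = assms[unfolded vector_bundle_def]
  show "finite_dim TYPE('f)" "subspace (fibre E p)" using v by blast+
  show "(U, \<Phi>) \<in> trivs E \<Longrightarrow> open U" using v by blast
  show "(U, \<Phi>) \<in> trivs E \<Longrightarrow> p \<in> U \<Longrightarrow> linear_between (fibre E p) UNIV (\<Phi> p)"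
    "(U, \<Phi>) \<in> trivs E \<Longrightarrow> p \<in> U \<Longrightarrow> bij_betw (\<Phi> p) (fibre E p) UNIV" using v by blast+
  have "p \<in> (\<Union>(U, \<Phi>)\<in>trivs E. U)" using v by blast
  then show "\<exists>U \<Phi>. (U, \<Phi>) \<in> trivs E \<and> p \<in> U" by blast
qed

context
  fixes E :: "('m, 'v::real_vector, 'f::real_inner, 'z) vbundle_scheme"
    and U \<Phi> p
  assumes E: "vector_bundle M E" and triv: "(U, \<Phi>) \<in> trivs E" "p \<in> U"
begin

lemma triv_triv_inv: "\<Phi> p (triv_inv E \<Phi> p x) = x"
  using triv_bij[OF E triv] by (simp add: bij_betw_inv_into_right)

lemma triv_inv_mem: "triv_inv E \<Phi> p x \<in> fibre E p"
  using triv_bij[OF E triv] by (metis UNIV_I bij_betw_imp_surj_on inv_into_into)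

lemma triv_inv_triv: "a \<in> fibre E p \<Longrightarrow> triv_inv E \<Phi> p (\<Phi> p a) = a"
  using triv_bij[OF E triv] by (simp add: bij_betw_inv_into_left)

lemma triv_inv_add: "triv_inv E \<Phi> p (x + y) = triv_inv E \<Phi> p x + triv_inv E \<Phi> p y"
proof -
  have "\<Phi> p (triv_inv E \<Phi> p x + triv_inv E \<Phi> p y) = x + y"
    using triv_linear[OF E triv] triv_inv_mem by (simp add: linear_between_def triv_triv_inv)
  then show ?thesis
    using triv_inv_triv[OF subspace_add[OF subspace_fibre[OF E] triv_inv_mem triv_inv_mem]] by metis
qed

lemma triv_inv_scaleR: "triv_inv E \<Phi> p (r *\<^sub>R x) = r *\<^sub>R triv_inv E \<Phi> p x"
proof -
  have "\<Phi> p (r *\<^sub>R triv_inv E \<Phi> p x) = r *\<^sub>R x"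
    using triv_linear[OF E triv] triv_inv_mem by (simp add: linear_between_def triv_triv_inv)
  then show ?thesis
    using triv_inv_triv[OF subspace_scale[OF subspace_fibre[OF E] triv_inv_mem]] by metis
qed

lemma linear_triv_inv:
  assumes "linear_between (fibre E p) W h"
  shows "linear (\<lambda>x. h (triv_inv E \<Phi> p x))"
  using assms triv_inv_mem
  by (intro linearI) (simp_all add: linear_between_def triv_inv_add triv_inv_scaleR)

end

text \<open>In a pair of trivialisations this is a smooth family of linear maps applied to a smooth
  function. Used for the anchor, for \<open>J\<close> and for the horizontal lift, it produces the
  global sections on which the algebraic identities are evaluated.\<close>

lemma bundle_map_section:
  assumes E: "vector_bundle M E" and F: "vector_bundle M F" and h: "bundle_map M E F h"
    and s: "s \<in> sections M E"
  shows "(\<lambda>p. h p (s p)) \<in> sections M F"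
proof -
  have h_lin: "linear_between (fibre E p) (fibre F p) (h p)" for p
    using h unfolding bundle_map_def by blast
  have s_mem: "s p \<in> fibre E p" for p using s unfolding sections_def by blast
  have "h p (s p) \<in> fibre F p" for p
    using h_lin s_mem unfolding linear_between_def by blast
  moreover have "smooth_map_on M W (\<lambda>p. \<Psi> p (h p (s p)))" if W: "(W, \<Psi>) \<in> trivs F" for W \<Psi>
  proof (rule smooth_map_on_local)
    fix q assume "q \<in> W"
    obtain U \<Phi> where U: "(U, \<Phi>) \<in> trivs E" "q \<in> U" using trivs_cover[OF E] by blast
    have op: "open (U \<inter> W)" using open_triv[OF E U(1)] open_triv[OF F W] by blast
    have lin: "linear (\<lambda>x. \<Psi> p (h p (triv_inv E \<Phi> p x)))" if "p \<in> U \<inter> W" for p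
    proof (rule linear_triv_inv[OF E U(1)])
      show "linear_between (fibre E p) UNIV (\<lambda>a. \<Psi> p (h p a))"
        using h_lin[of p] triv_linear[OF F W, of p] that unfolding linear_between_def
        by (simp add: image_subset_iff)
    qed (use that in simp)
    have "smooth_map_on M (U \<inter> W) (\<lambda>p. \<Psi> p (h p (triv_inv E \<Phi> p (\<Phi> p (s p)))))"
    proof (rule smooth_map_on_apply[OF finite_dim_fibre[OF E] op lin])
      show "smooth_map_on M (U \<inter> W) (\<lambda>p. \<Psi> p (h p (triv_inv E \<Phi> p x)))" for x
        using h U(1) W unfolding bundle_map_def by blast
      have "smooth_map_on M U (\<lambda>p. \<Phi> p (s p))" using s U(1) unfolding sections_def by blast
      then show "smooth_map_on M (U \<inter> W) (\<lambda>p. \<Phi> p (s p))"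
        by (rule smooth_map_on_subset) blast
    qed
    then have "smooth_map_on M (U \<inter> W) (\<lambda>p. \<Psi> p (h p (s p)))"
      by (rule smooth_map_on_cong[OF op, rotated])
        (simp add: triv_inv_triv[OF E U(1) _ s_mem])
    then show "\<exists>V. open V \<and> q \<in> V \<and> smooth_map_on M V (\<lambda>p. \<Psi> p (h p (s p)))"
      using op U(2) \<open>q \<in> W\<close> by blast
  qed
  ultimately show ?thesis unfolding sections_def by blast
qed

lemma bilinear_triv_inv:
  assumes E: "vector_bundle M E" and b: "bilinear_form M E \<beta>" and U: "(U, \<Phi>) \<in> trivs E" "p \<in> U"
  shows "bilinear (\<lambda>x y. \<beta> p (triv_inv E \<Phi> p x) (triv_inv E \<Phi> p y))"
proof -
  have l: "linear_between (fibre E p) UNIV (\<beta> p a)" "linear_between (fibre E p) UNIV (\<lambda>b. \<beta> p b a)"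
    if "a \<in> fibre E p" for a
    using b that unfolding bilinear_form_def by blast+
  show ?thesis unfolding bilinear_def
    by (intro conjI allI linear_triv_inv[OF E U l(1)[OF triv_inv_mem[OF E U]]]
        linear_triv_inv[OF E U l(2)[OF triv_inv_mem[OF E U]]])
qed

lemma bilinear_form_sections:
  assumes E: "vector_bundle M E" and b: "bilinear_form M E \<beta>"
    and s: "s \<in> sections M E" and t: "t \<in> sections M E"
  shows "smooth_map_on M UNIV (\<lambda>p. \<beta> p (s p) (t p))"
proof (rule smooth_map_on_local)
  fix q
  have mem: "s p \<in> fibre E p" "t p \<in> fibre E p" for p
    using s t unfolding sections_def by blast+
  obtain U \<Phi> where U: "(U, \<Phi>) \<in> trivs E" "q \<in> U" using trivs_cover[OF E] by blast
  have op: "open U" using open_triv[OF E U(1)] .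
  have sm: "smooth_map_on M U (\<lambda>p. \<beta> p (triv_inv E \<Phi> p x) (triv_inv E \<Phi> p y))" for x y
    using b U(1) unfolding bilinear_form_def by blast
  have "smooth_map_on M U (\<lambda>p. \<Phi> p (s p))" "smooth_map_on M U (\<lambda>p. \<Phi> p (t p))"
    using s t U(1) unfolding sections_def by blast+
  from smooth_map_on_apply2[OF finite_dim_fibre[OF E] op bilinear_triv_inv[OF E b U(1)] sm this]
  have "smooth_map_on M U (\<lambda>p. \<beta> p (s p) (t p))"
    by (rule smooth_map_on_cong[OF op, rotated]) (simp_all add: triv_inv_triv[OF E U(1) _ mem(1)]
        triv_inv_triv[OF E U(1) _ mem(2)])
  then show "\<exists>V. open V \<and> q \<in> V \<and> smooth_map_on M V (\<lambda>p. \<beta> p (s p) (t p))"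
    using op U(2) by blast
qed

section \<open>Module operations on sections\<close>

lemma sections_add:
  assumes E: "vector_bundle M E" and s: "s \<in> sections M E" and t: "t \<in> sections M E"
  shows "(\<lambda>p. s p + t p) \<in> sections M E"
proof -
  have mem: "s p \<in> fibre E p" "t p \<in> fibre E p" for p
    using s t unfolding sections_def by blast+
  have "smooth_map_on M U (\<lambda>p. \<Phi> p (s p + t p))" if U: "(U, \<Phi>) \<in> trivs E" for U \<Phi>
  proof (rule smooth_map_on_cong[OF open_triv[OF E U]])
    show "smooth_map_on M U (\<lambda>p. \<Phi> p (s p) + \<Phi> p (t p))"
      using s t U unfolding sections_def by (intro smooth_map_on_add[OF open_triv[OF E U]]) blast+
    show "\<Phi> p (s p) + \<Phi> p (t p) = \<Phi> p (s p + t p)" if "p \<in> U" for p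
      using triv_linear[OF E U that] mem by (simp add: linear_between_def)
  qed
  then show ?thesis
    using mem subspace_add[OF subspace_fibre[OF E]] unfolding sections_def by blast
qed

lemma sections_scaleR:
  assumes E: "vector_bundle M E" and s: "s \<in> sections M E" and f: "smooth_map_on M UNIV f"
  shows "(\<lambda>p. f p *\<^sub>R s p) \<in> sections M E"
proof -
  have mem: "s p \<in> fibre E p" for p
    using s unfolding sections_def by blast
  have "smooth_map_on M U (\<lambda>p. \<Phi> p (f p *\<^sub>R s p))" if U: "(U, \<Phi>) \<in> trivs E" for U \<Phi>
  proof (rule smooth_map_on_cong[OF open_triv[OF E U]])
    have "smooth_map_on M U f" by (rule smooth_map_on_subset[OF f]) simp
    moreover have "smooth_map_on M U (\<lambda>p. \<Phi> p (s p))" using s U unfolding sections_def by blast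
    ultimately show "smooth_map_on M U (\<lambda>p. f p *\<^sub>R \<Phi> p (s p))"
      by (rule smooth_map_on_scaleR[OF open_triv[OF E U]])
    show "f p *\<^sub>R \<Phi> p (s p) = \<Phi> p (f p *\<^sub>R s p)" if "p \<in> U" for p
      using triv_linear[OF E U that] mem by (simp add: linear_between_def)
  qed
  then show ?thesis
    using mem subspace_scale[OF subspace_fibre[OF E]] unfolding sections_def by blast
qed

lemma sections_uminus:
  assumes "vector_bundle M E" "s \<in> sections M E"
  shows "(\<lambda>p. - s p) \<in> sections M E"
  using sections_scaleR[OF assms smooth_map_on_const[of _ "-1"]] by simp

lemma sections_diff:
  assumes "vector_bundle M E" "s \<in> sections M E" "t \<in> sections M E"
  shows "(\<lambda>p. s p - t p) \<in> sections M E"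
  using sections_add[OF assms(1,2) sections_uminus[OF assms(1,3)]] by simp

lemma sections_zero:
  assumes E: "vector_bundle M E"
  shows "(\<lambda>p. 0) \<in> sections M E"
proof -
  have "smooth_map_on M U (\<lambda>p. \<Phi> p 0)" if U: "(U, \<Phi>) \<in> trivs E" for U \<Phi>
  proof (rule smooth_map_on_cong[OF open_triv[OF E U] _ smooth_map_on_const[of U 0]])
    show "0 = \<Phi> p 0" if "p \<in> U" for p
    proof -
      have "\<forall>r. \<Phi> p (r *\<^sub>R 0) = r *\<^sub>R \<Phi> p 0"
        using triv_linear[OF E U that] subspace_0[OF subspace_fibre[OF E]]
        unfolding linear_between_def by blast
      then show ?thesis by (metis scaleR_zero_left)
    qed
  qed
  then show ?thesis
    using subspace_0[OF subspace_fibre[OF E]] unfolding sections_def by blast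
qed

section \<open>The tangent bundle\<close>

abbreviation coord_change :: "('m, 'e) chart \<Rightarrow> ('m, 'e) chart \<Rightarrow> 'e \<Rightarrow> 'e \<Rightarrow> 'e" where
  "coord_change c d x \<equiv> frechet_derivative (snd d \<circ> chart_inv c) (at x)"

lemma coord_change_derivative:
  assumes "c \<in> M" "d \<in> M" "p \<in> fst c" "p \<in> fst d"
  shows "(snd d \<circ> chart_inv c has_derivative coord_change c d (snd c p)) (at (snd c p))"
  using transition_smooth[OF assms(1,2)] assms(3,4)
  unfolding smooth_on_def by (blast intro: Ck_on_SucD)

lemma coord_change_chain:
  assumes c: "c \<in> M" "p \<in> fst c" and d: "d \<in> M" "p \<in> fst d" and e: "e \<in> M" "p \<in> fst e"
  shows "coord_change d e (snd d p) (coord_change c d (snd c p) v) = coord_change c e (snd c p) v"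
proof -
  have "((snd e \<circ> chart_inv d) \<circ> (snd d \<circ> chart_inv c) has_derivative
      coord_change d e (snd d p) \<circ> coord_change c d (snd c p)) (at (snd c p))"
    using coord_change_derivative[OF c(1) d(1) c(2) d(2)]
      coord_change_derivative[OF d(1) e(1) d(2) e(2)] c
    by (intro diff_chain_at) (auto simp: o_def)
  then have "(snd e \<circ> chart_inv c has_derivative
      coord_change d e (snd d p) \<circ> coord_change c d (snd c p)) (at (snd c p))"
    by (rule has_derivative_transform_within_open[OF _ open_chart_image[OF c(1) open_chart[OF d(1)]]])
      (use c d in auto)
  from frechet_derivative_at[OF this] show ?thesis by (metis comp_apply)
qed

lemma coord_change_id:
  assumes "c \<in> M" "p \<in> fst c"
  shows "coord_change c c (snd c p) v = v"
proof -
  have "(snd c \<circ> chart_inv c has_derivative id) (at (snd c p))"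
    by (rule has_derivative_transform_within_open[OF has_derivative_id
          open_chart_image[OF assms(1) open_UNIV]]) (use assms in auto)
  from frechet_derivative_at[OF this] show ?thesis by (metis id_apply)
qed

lemma tangent_coord_eq: "tangent_coord M c p = coord_change (chart_at M p) c (snd (chart_at M p) p)"
  unfolding tangent_coord_def by (rule ext) simp

lemma
  assumes "c \<in> M" "p \<in> fst c"
  shows tangent_coord_linear: "linear (tangent_coord M c p)"
    and tangent_coord_inverse: "tangent_coord M c p (coord_change c (chart_at M p) (snd c p) x) = x"
    and tangent_coord_bij: "bij (tangent_coord M c p)"
proof -
  note a = chart_at[of p]
  show "linear (tangent_coord M c p)"
    unfolding tangent_coord_eq
    using has_derivative_linear[OF coord_change_derivative[OF a(1) assms(1) a(2) assms(2)]] .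
  show inv: "tangent_coord M c p (coord_change c (chart_at M p) (snd c p) x) = x" for x
    unfolding tangent_coord_eq
    using coord_change_chain[OF assms a assms] coord_change_id[OF assms] by simp
  have "coord_change c (chart_at M p) (snd c p) (tangent_coord M c p x) = x" for x
    unfolding tangent_coord_eq
    using coord_change_chain[OF a assms a] coord_change_id[OF a] by simp
  with inv show "bij (tangent_coord M c p)"
    by (metis bij_betw_byWitness UNIV_I subset_UNIV)
qed

text \<open>\<open>chart_at\<close> is an arbitrary choice that may jump with p. The chain rule
  cancels it and leaves the derivative of a genuine coordinate change, which is smooth in p.\<close>

lemma tangent_transition:
  assumes "c \<in> M" "p \<in> fst c" "d \<in> M" "p \<in> fst d"
  shows "tangent_coord M d p (inv (tangent_coord M c p) x) = coord_change c d (snd c p) x"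
proof -
  have "inv (tangent_coord M c p) x = coord_change c (chart_at M p) (snd c p) x"
    using tangent_coord_inverse[OF assms(1,2)] tangent_coord_bij[OF assms(1,2)]
    by (metis bij_is_inj inv_f_f)
  then show ?thesis
    unfolding tangent_coord_eq using coord_change_chain[OF assms(1,2) chart_at assms(3,4)] by simp
qed

lemma coord_change_smooth:
  assumes c: "c \<in> M" and d: "d \<in> M"
  shows "smooth_map_on M (fst c \<inter> fst d) (\<lambda>p. coord_change c d (snd c p) v)"
proof (rule smooth_map_onI)
  fix e k assume e: "e \<in> M"
  let ?S = "snd e ` (fst e \<inter> (fst c \<inter> fst d))"
  have op: "open ?S" using open_chart_image[OF e] open_chart[OF c] open_chart[OF d] by blast
  have "Ck_on k (snd e ` (fst e \<inter> fst c)) (snd c \<circ> chart_inv e)"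
    using transition_smooth[OF e c] unfolding smooth_on_def by blast
  then have f: "Ck_on k ?S (snd c \<circ> chart_inv e)"
    by (rule Ck_on_subset) blast
  \<comment> \<open>One order is spent on the derivative, hence \<open>Suc k\<close>.\<close>
  have "Ck_on (Suc k) (snd c ` (fst c \<inter> fst d)) (snd d \<circ> chart_inv c)"
    using transition_smooth[OF c d] unfolding smooth_on_def by blast
  then have g: "Ck_on k (snd c ` (fst c \<inter> fst d)) (\<lambda>x. coord_change c d x v)" by simp
  have "(snd c \<circ> chart_inv e) ` ?S \<subseteq> snd c ` (fst c \<inter> fst d)" using e by auto
  from Ck_on_compose[OF finite_dim_model op this f g]
  show "Ck_on k ?S (\<lambda>x. coord_change c d (snd c (chart_inv e x)) v)" by (simp add: o_def)
qed

lemma tangent_transition_smooth: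
  assumes "c \<in> M" "d \<in> M"
  shows "smooth_map_on M (fst c \<inter> fst d) (\<lambda>p. tangent_coord M d p (inv (tangent_coord M c p) x))"
  by (rule smooth_map_on_cong[OF _ _ coord_change_smooth[OF assms]])
    (use assms tangent_transition open_chart in \<open>simp_all add: open_Int\<close>)

lemma tangent_vector_bundle: "vector_bundle M (tangent_algebroid M)"
  using finite_dim_model open_chart tangent_coord_linear tangent_coord_bij charts_cover
    tangent_transition_smooth
  unfolding vector_bundle_def tangent_algebroid_def
  by (auto simp: linear_between_def linear_add linear_scale image_iff)

lemma tangent_anchor_bundle_map:
  "bundle_map M (tangent_algebroid M) (tangent_algebroid M) (anchor (tangent_algebroid M))"
  using tangent_transition_smooth
  unfolding bundle_map_def tangent_algebroid_def by (auto simp: linear_between_def)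

end

section \<open>Brackets of sections\<close>

lemma linear_between_0:
  assumes "subspace V" "linear_between V W h"
  shows "h 0 = 0"
proof -
  have "h (0 *\<^sub>R 0) = 0 *\<^sub>R h 0"
    using assms subspace_0 unfolding linear_between_def by blast
  then show ?thesis by simp
qed

lemma linear_between_uminus:
  assumes "a \<in> V" "linear_between V W h"
  shows "h (- a) = - h a"
proof -
  have "h ((- 1) *\<^sub>R a) = (- 1) *\<^sub>R h a"
    using assms unfolding linear_between_def by blast
  then show ?thesis by simp
qed

lemma linear_between_diff:
  assumes "subspace V" "linear_between V W h" "a \<in> V" "b \<in> V"
  shows "h (a - b) = h a - h b"
proof -
  have "h (a + (- b)) = h a + h (- b)"
    using assms subspace_neg unfolding linear_between_def by blast
  then show ?thesis using linear_between_uminus[OF assms(4,2)] by simp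
qed

text \<open>Smoothness of \<open>f\<close> matters: for a non-differentiable function
  \<open>frechet_derivative\<close> is an arbitrary choice and may fail to send 0 to 0. The lemma
  removes the terms of the exterior derivative that differentiate along a section of L.\<close>

lemma (in manifold) vf_apply_zero:
  assumes f: "smooth_map_on M UNIV f" and "X p = 0"
  shows "vf_apply M X f p = 0"
proof -
  let ?c = "chart_at M p"
  have "Ck_on (Suc 0) (snd ?c ` fst ?c) (f \<circ> chart_inv ?c)"
    using smooth_map_onD[OF f chart_at(1)[of p], of "Suc 0"] by (simp add: comp_def)
  from Ck_on_SucD[OF this, of "snd ?c p"]
  have "linear (frechet_derivative (f \<circ> chart_inv ?c) (at (snd ?c p)))"
    using chart_at(2)[of p] has_derivative_linear by blast
  then show ?thesis
    using assms(2) by (simp add: vf_apply_def dir_deriv_def linear_0)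
qed

locale algebroid = manifold M
  for M :: "('m::{t2_space,second_countable_topology}, 'e::real_inner) chart set" +
  fixes A :: "('m, 'v::real_vector, 'f::real_inner, 'e) lie_algebroid"
  assumes lie_algebroid: "lie_algebroid M A"
begin

abbreviation TM :: "('m, 'e, 'e, 'e) lie_algebroid" where
  "TM \<equiv> tangent_algebroid M"

abbreviation Secs :: "('m \<Rightarrow> 'v) set" (\<open>\<Gamma>\<close>) where
  "\<Gamma> \<equiv> sections M A"

abbreviation Iso_secs :: "('m \<Rightarrow> 'v) set" (\<open>\<Gamma>\<^sub>L\<close>) where
  "\<Gamma>\<^sub>L \<equiv> isotropy_sections M A"

abbreviation br :: "('m \<Rightarrow> 'v) \<Rightarrow> ('m \<Rightarrow> 'v) \<Rightarrow> 'm \<Rightarrow> 'v" where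
  "br \<equiv> bracket A"

lemma fibre_TM [simp]: "fibre TM p = UNIV"
  and anchor_TM [simp]: "anchor TM p v = v"
  and bracket_TM [simp]: "bracket TM = vf_bracket M"
  and anchor_sec_TM [simp]: "anchor_sec TM X = X"
  by (simp_all add: tangent_algebroid_def anchor_sec_def)

lemma vb: "vector_bundle M A"
  and anchor_bundle_map: "bundle_map M A TM (anchor A)"
  and br_sec: "S \<in> \<Gamma> \<Longrightarrow> T \<in> \<Gamma> \<Longrightarrow> br S T \<in> \<Gamma>"
  and br_add_left': "S \<in> \<Gamma> \<Longrightarrow> T \<in> \<Gamma> \<Longrightarrow> R \<in> \<Gamma> \<Longrightarrow>
    br (\<lambda>p. S p + T p) R = (\<lambda>p. br S R p + br T R p)"
  and br_scale_left': "S \<in> \<Gamma> \<Longrightarrow> T \<in> \<Gamma> \<Longrightarrow> br (\<lambda>p. r *\<^sub>R S p) T = (\<lambda>p. r *\<^sub>R br S T p)"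
  and br_skew': "S \<in> \<Gamma> \<Longrightarrow> T \<in> \<Gamma> \<Longrightarrow> br S T = (\<lambda>p. - br T S p)"
  and br_jacobi: "S \<in> \<Gamma> \<Longrightarrow> T \<in> \<Gamma> \<Longrightarrow> R \<in> \<Gamma> \<Longrightarrow>
    br S (br T R) p + br T (br R S) p + br R (br S T) p = 0"
  and anchor_br': "S \<in> \<Gamma> \<Longrightarrow> T \<in> \<Gamma> \<Longrightarrow>
    anchor_sec A (br S T) = vf_bracket M (anchor_sec A S) (anchor_sec A T)"
  and br_leibniz: "smooth_map_on M UNIV f \<Longrightarrow> S \<in> \<Gamma> \<Longrightarrow> T \<in> \<Gamma> \<Longrightarrow>
    br S (\<lambda>p. f p *\<^sub>R T p) = (\<lambda>p. f p *\<^sub>R br S T p + vf_apply M (anchor_sec A S) f p *\<^sub>R T p)"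
  using lie_algebroid unfolding lie_algebroid_def by blast+

lemma sec_mem: "S \<in> \<Gamma> \<Longrightarrow> S p \<in> fibre A p"
  unfolding sections_def by blast

lemma fibre_closed [simp]:
  "0 \<in> fibre A p"
  "a \<in> fibre A p \<Longrightarrow> b \<in> fibre A p \<Longrightarrow> a + b \<in> fibre A p"
  "a \<in> fibre A p \<Longrightarrow> b \<in> fibre A p \<Longrightarrow> a - b \<in> fibre A p"
  "a \<in> fibre A p \<Longrightarrow> - a \<in> fibre A p"
  "a \<in> fibre A p \<Longrightarrow> r *\<^sub>R a \<in> fibre A p"
  using subspace_fibre[OF vb]
  by (auto intro: subspace_0 subspace_add subspace_diff subspace_neg subspace_scale)

lemma br_skew: "S \<in> \<Gamma> \<Longrightarrow> T \<in> \<Gamma> \<Longrightarrow> br S T p = - br T S p"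
  by (metis br_skew')

lemma br_add_left: "S \<in> \<Gamma> \<Longrightarrow> T \<in> \<Gamma> \<Longrightarrow> R \<in> \<Gamma> \<Longrightarrow> br (\<lambda>p. S p + T p) R p = br S R p + br T R p"
  by (simp add: br_add_left')

lemma br_add_right:
  assumes "S \<in> \<Gamma>" "T \<in> \<Gamma>" "R \<in> \<Gamma>"
  shows "br R (\<lambda>p. S p + T p) p = br R S p + br R T p"
  using br_skew[OF assms(3) sections_add[OF vb assms(1,2)]] br_add_left[OF assms]
    br_skew[OF assms(1,3)] br_skew[OF assms(2,3)] by simp

lemma br_uminus_left: "S \<in> \<Gamma> \<Longrightarrow> T \<in> \<Gamma> \<Longrightarrow> br (\<lambda>p. - S p) T p = - br S T p"
  using br_scale_left'[of S T "-1"] by simp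

lemma br_uminus_right: "S \<in> \<Gamma> \<Longrightarrow> T \<in> \<Gamma> \<Longrightarrow> br S (\<lambda>p. - T p) p = - br S T p"
  using br_skew[of S "\<lambda>p. - T p"] br_uminus_left[of T S] br_skew[of S T] sections_uminus[OF vb]
  by simp

lemma br_zero_right:
  assumes "S \<in> \<Gamma>"
  shows "br S (\<lambda>p. 0) p = 0"
  using br_scale_left'[OF sections_zero[OF vb] assms, of 0] br_skew[OF assms sections_zero[OF vb]]
  by simp

lemma anchor_linear: "linear_between (fibre A p) UNIV (anchor A p)"
  using anchor_bundle_map unfolding bundle_map_def by simp

lemma anchor_add: "a \<in> fibre A p \<Longrightarrow> b \<in> fibre A p \<Longrightarrow> anchor A p (a + b) = anchor A p a + anchor A p b"
  and anchor_scaleR: "a \<in> fibre A p \<Longrightarrow> anchor A p (r *\<^sub>R a) = r *\<^sub>R anchor A p a"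
  using anchor_linear[of p] unfolding linear_between_def by blast+

lemma anchor_zero: "anchor A p 0 = 0"
  and anchor_uminus: "a \<in> fibre A p \<Longrightarrow> anchor A p (- a) = - anchor A p a"
  and anchor_diff: "a \<in> fibre A p \<Longrightarrow> b \<in> fibre A p \<Longrightarrow> anchor A p (a - b) = anchor A p a - anchor A p b"
  by (rule linear_between_0[OF subspace_fibre[OF vb] anchor_linear]
      linear_between_uminus[OF _ anchor_linear]
      linear_between_diff[OF subspace_fibre[OF vb] anchor_linear]; assumption)+

lemma anchor_sec_section: "S \<in> \<Gamma> \<Longrightarrow> anchor_sec A S \<in> sections M TM"
  unfolding anchor_sec_def by (rule bundle_map_section[OF vb tangent_vector_bundle anchor_bundle_map])

lemma anchor_br: "S \<in> \<Gamma> \<Longrightarrow> T \<in> \<Gamma> \<Longrightarrow>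
    anchor A p (br S T p) = vf_bracket M (anchor_sec A S) (anchor_sec A T) p"
  using anchor_br' by (metis anchor_sec_def)

lemma iso_sec: "S \<in> \<Gamma>\<^sub>L \<Longrightarrow> S \<in> \<Gamma>"
  and iso_mem: "S \<in> \<Gamma>\<^sub>L \<Longrightarrow> S p \<in> isotropy A p"
  and iso_anchor: "S \<in> \<Gamma>\<^sub>L \<Longrightarrow> anchor_sec A S = (\<lambda>p. 0)"
  and isoI: "S \<in> \<Gamma> \<Longrightarrow> (\<And>p. anchor A p (S p) = 0) \<Longrightarrow> S \<in> \<Gamma>\<^sub>L"
  by (auto simp: isotropy_sections_def isotropy_def anchor_sec_def sec_mem)

lemma iso_anchor_zero: "S \<in> \<Gamma>\<^sub>L \<Longrightarrow> anchor A p (S p) = 0"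
  using iso_mem[of S p] by (simp add: isotropy_def)

lemma iso_add: "S \<in> \<Gamma>\<^sub>L \<Longrightarrow> T \<in> \<Gamma>\<^sub>L \<Longrightarrow> (\<lambda>p. S p + T p) \<in> \<Gamma>\<^sub>L"
  by (intro isoI sections_add[OF vb])
    (simp_all add: anchor_add sec_mem iso_sec iso_anchor_zero)

lemma iso_diff: "S \<in> \<Gamma>\<^sub>L \<Longrightarrow> T \<in> \<Gamma>\<^sub>L \<Longrightarrow> (\<lambda>p. S p - T p) \<in> \<Gamma>\<^sub>L"
  by (intro isoI sections_diff[OF vb])
    (simp_all add: anchor_diff sec_mem iso_sec iso_anchor_zero)

text \<open>The value of \<^const>\<open>vf_bracket\<close> on \<open>(X, 0)\<close> is read off from \<open>[a, 0] = 0\<close> in \<open>A\<close>.\<close>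

lemma br_iso:
  assumes "a \<in> \<Gamma>" "S \<in> \<Gamma>\<^sub>L"
  shows "br a S \<in> \<Gamma>\<^sub>L"
proof (rule isoI)
  show "br a S \<in> \<Gamma>" by (intro br_sec assms(1) iso_sec assms(2))
  note z = sections_zero[OF vb]
  have "anchor_sec A S = anchor_sec A (\<lambda>p. 0)"
    using iso_anchor[OF assms(2)] by (simp add: anchor_sec_def anchor_zero)
  then show "anchor A p (br a S p) = 0" for p
    using anchor_br[OF assms(1) iso_sec[OF assms(2)], of p] anchor_br[OF assms(1) z, of p]
      br_zero_right[OF assms(1), of p] anchor_zero[of p] by simp
qed

end

section \<open>The isotropy bundle is abelian\<close>

locale compatible_algebroid = algebroid M A
  for M :: "('m::{t2_space,second_countable_topology}, 'e::real_inner) chart set"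
    and A :: "('m, 'v::real_vector, 'f::real_inner, 'e) lie_algebroid" +
  fixes \<omega> g :: "'m \<Rightarrow> 'v \<Rightarrow> 'v \<Rightarrow> real"
    and J :: "'m \<Rightarrow> 'v \<Rightarrow> 'v"
  assumes transitive: "transitive A"
    and triple: "compatible_triple M A \<omega> J g"
    and invariant: "invariant_metric M A g"
    and admissible: "admissible M A J"
begin

lemma omega_symplectic: "symplectic_form M A \<omega>"
  and J_almost_complex: "almost_complex M A J"
  and g_metric: "riemannian_metric M A g"
  and g_J_J: "a \<in> fibre A p \<Longrightarrow> b \<in> fibre A p \<Longrightarrow> g p (J p a) (J p b) = g p a b"
  and omega_g: "a \<in> fibre A p \<Longrightarrow> b \<in> fibre A p \<Longrightarrow> \<omega> p a b = g p a (J p b)"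
  using triple unfolding compatible_triple_def by simp_all

lemma omega_form: "bilinear_form M A \<omega>"
  and omega_alt: "a \<in> fibre A p \<Longrightarrow> \<omega> p a a = 0"
  and omega_closed: "R \<in> \<Gamma> \<Longrightarrow> S \<in> \<Gamma> \<Longrightarrow> T \<in> \<Gamma> \<Longrightarrow> ext_deriv2 M A \<omega> R S T p = 0"
  using omega_symplectic unfolding symplectic_form_def by simp_all

lemma J_bundle_map: "bundle_map M A A J"
  and J_J: "a \<in> fibre A p \<Longrightarrow> J p (J p a) = - a"
  using J_almost_complex unfolding almost_complex_def by simp_all

lemma g_form: "bilinear_form M A g"
  and g_sym: "a \<in> fibre A p \<Longrightarrow> b \<in> fibre A p \<Longrightarrow> g p a b = g p b a"
  and g_pos: "a \<in> fibre A p \<Longrightarrow> a \<noteq> 0 \<Longrightarrow> g p a a > 0"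
  using g_metric unfolding riemannian_metric_def by simp_all

lemma J_linear: "linear_between (fibre A p) (fibre A p) (J p)"
  using J_bundle_map unfolding bundle_map_def by blast

lemma J_mem: "a \<in> fibre A p \<Longrightarrow> J p a \<in> fibre A p"
  and J_add: "a \<in> fibre A p \<Longrightarrow> b \<in> fibre A p \<Longrightarrow> J p (a + b) = J p a + J p b"
  using J_linear[of p] unfolding linear_between_def by blast+

lemma J_uminus: "a \<in> fibre A p \<Longrightarrow> J p (- a) = - J p a"
  by (rule linear_between_uminus[OF _ J_linear])

lemma g_linear: "a \<in> fibre A p \<Longrightarrow> linear_between (fibre A p) UNIV (g p a)"
  "a \<in> fibre A p \<Longrightarrow> linear_between (fibre A p) UNIV (\<lambda>b. g p b a)"
  using g_form unfolding bilinear_form_def by blast+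

lemma g_add_left: "a \<in> fibre A p \<Longrightarrow> b \<in> fibre A p \<Longrightarrow> c \<in> fibre A p \<Longrightarrow> g p (a + b) c = g p a c + g p b c"
  and g_scaleR_left: "a \<in> fibre A p \<Longrightarrow> c \<in> fibre A p \<Longrightarrow> g p (r *\<^sub>R a) c = r * g p a c"
  using g_linear[of c p] unfolding linear_between_def by simp_all

lemma g_zero_left: "c \<in> fibre A p \<Longrightarrow> g p 0 c = 0"
  and g_diff_left: "a \<in> fibre A p \<Longrightarrow> b \<in> fibre A p \<Longrightarrow> c \<in> fibre A p \<Longrightarrow> g p (a - b) c = g p a c - g p b c"
  and g_uminus_right: "a \<in> fibre A p \<Longrightarrow> c \<in> fibre A p \<Longrightarrow> g p c (- a) = - g p c a"
  by (rule linear_between_0[OF subspace_fibre[OF vb] g_linear(2)]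
      linear_between_uminus[OF _ g_linear(1)]
      linear_between_diff[OF subspace_fibre[OF vb] g_linear(2)]; assumption)+

lemma g_J_skew:
  assumes "a \<in> fibre A p" "b \<in> fibre A p"
  shows "g p (J p a) b = - g p a (J p b)"
  using g_J_J[OF assms(1) J_mem[OF assms(2)]] J_J[OF assms(2)] J_mem[OF assms(1)] assms
  by (simp add: g_uminus_right)

lemma g_zero_imp_zero: "a \<in> fibre A p \<Longrightarrow> g p a a = 0 \<Longrightarrow> a = 0"
  using g_pos by fastforce

lemma isotropy_fibre: "a \<in> isotropy A p \<Longrightarrow> a \<in> fibre A p"
  and isotropy_anchor: "a \<in> isotropy A p \<Longrightarrow> anchor A p a = 0"
  by (simp_all add: isotropy_def)

text \<open>Admissibility read on the kernel of the anchor. It makes L a complex subbundle, on which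
  the derivation argument and the metric description of E rest.\<close>

lemma J_isotropy:
  assumes "a \<in> isotropy A p"
  shows "J p a \<in> isotropy A p"
proof -
  obtain J\<^sub>M where JM: "almost_complex M TM J\<^sub>M"
    "\<And>p a. a \<in> fibre A p \<Longrightarrow> anchor A p (J p a) = J\<^sub>M p (anchor A p a)"
    using admissible unfolding admissible_def by blast
  have "linear_between UNIV UNIV (J\<^sub>M p)"
    using JM(1) unfolding almost_complex_def bundle_map_def by simp
  from linear_between_0[OF _ this] show ?thesis
    using assms JM(2)[of a p] J_mem by (simp add: isotropy_def)
qed

lemma J_sec: "S \<in> \<Gamma> \<Longrightarrow> (\<lambda>p. J p (S p)) \<in> \<Gamma>"
  by (rule bundle_map_section[OF vb vb J_bundle_map])

lemma J_iso: "S \<in> \<Gamma>\<^sub>L \<Longrightarrow> (\<lambda>p. J p (S p)) \<in> \<Gamma>\<^sub>L"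
  using J_sec J_isotropy by (simp add: isotropy_sections_def)

lemma g_bracket_invariant:
  "R \<in> \<Gamma>\<^sub>L \<Longrightarrow> S \<in> \<Gamma>\<^sub>L \<Longrightarrow> T \<in> \<Gamma>\<^sub>L \<Longrightarrow> g p (br R S p) (T p) = g p (R p) (br S T p)"
  using invariant unfolding invariant_metric_def by blast

text \<open>\<open>V\<close> is itself one of the test sections, so positivity of g decides.\<close>

lemma iso_zeroI:
  assumes "V \<in> \<Gamma>\<^sub>L" "\<And>T p. T \<in> \<Gamma>\<^sub>L \<Longrightarrow> g p (V p) (T p) = 0"
  shows "V p = 0"
  using g_zero_imp_zero[OF sec_mem[OF iso_sec[OF assms(1)]] assms(2)[OF assms(1)]] .

lemma omega_smooth: "S \<in> \<Gamma> \<Longrightarrow> T \<in> \<Gamma> \<Longrightarrow> smooth_map_on M UNIV (\<lambda>p. \<omega> p (S p) (T p))"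
  by (rule bilinear_form_sections[OF vb omega_form])

text \<open>All anchors vanish, so closedness on (R, S, T) is the algebraic relation
  \<omega>([R, S], T) - \<omega>([R, T], S) + \<omega>([S, T], R) = 0. Substituting \<omega> = g(.,
  J .) and using invariance to free \<open>T\<close> from the brackets turns it into g(V, T) = 0 for
  the defect V of the derivation rule.\<close>

lemma J_derivation:
  assumes R: "R \<in> \<Gamma>\<^sub>L" and S: "S \<in> \<Gamma>\<^sub>L"
  shows "J p (br R S p) = br (\<lambda>q. J q (R q)) S p + br R (\<lambda>q. J q (S q)) p"
proof -
  let ?JR = "\<lambda>q. J q (R q)" and ?JS = "\<lambda>q. J q (S q)"
  note JR = J_iso[OF R] and JS = J_iso[OF S]
  note b = br_iso[OF iso_sec]
  let ?V = "\<lambda>q. br ?JR S q + br R ?JS q - J q (br R S q)"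
  have V: "?V \<in> \<Gamma>\<^sub>L"
    by (intro iso_add iso_diff b R S JR JS J_iso)
  have "?V p = 0"
  proof (rule iso_zeroI[OF V])
    fix T q assume T: "T \<in> \<Gamma>\<^sub>L"
    note m = sec_mem[OF iso_sec]
    have z: "vf_apply M (\<lambda>p. 0) (\<lambda>p. \<omega> p (P p) (Q p)) q = 0" if "P \<in> \<Gamma>\<^sub>L" "Q \<in> \<Gamma>\<^sub>L" for P Q
      by (intro vf_apply_zero omega_smooth iso_sec that refl)
    have "g q (br R S q) (J q (T q)) - g q (br R T q) (J q (S q)) + g q (br S T q) (J q (R q)) = 0"
      using omega_closed[OF iso_sec[OF R] iso_sec[OF S] iso_sec[OF T], of q]
        z[OF R S] z[OF R T] z[OF S T]
      by (simp add: ext_deriv2_def iso_anchor[OF R] iso_anchor[OF S] iso_anchor[OF T]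
          R S T omega_g m b)
    moreover have "g q (br R S q) (J q (T q)) = - g q (J q (br R S q)) (T q)"
      using g_J_skew[of "br R S q" q "T q"] m R S T b by simp
    \<comment> \<open>g([R, T], JS) = g(R, [T, JS]) = - g(R, [JS, T]) = - g([R, JS], T).\<close>
    moreover have "g q (br R T q) (J q (S q)) = - g q (br R ?JS q) (T q)"
      using g_bracket_invariant[OF R T JS] g_bracket_invariant[OF R JS T]
        br_skew[OF iso_sec[OF T] iso_sec[OF JS]] m R T JS b by (simp add: g_uminus_right)
    moreover have "g q (br S T q) (J q (R q)) = g q (br ?JR S q) (T q)"
      using g_bracket_invariant[OF JR S T, of q] g_sym[of "br S T q" q "J q (R q)"] m R S T JR b
      by (simp add: J_mem)
    ultimately show "g q (?V q) (T q) = 0"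
      using m T b R S JR JS by (simp add: g_diff_left g_add_left J_mem)
  qed
  then show ?thesis by simp
qed

text \<open>A derivation \<open>J\<close> with \<open>J\<^sup>2 = -1\<close> satisfies \<open>[JR, JS] = [R, S] / 2\<close>; applied to
  \<open>JR, JS\<close> this gives \<open>[R, S] = [R, S] / 4\<close>.\<close>

lemma isotropy_bracket_zero:
  assumes "R \<in> \<Gamma>\<^sub>L" "S \<in> \<Gamma>\<^sub>L"
  shows "br R S p = 0"
proof -
  have half: "br R S p = 2 *\<^sub>R br (\<lambda>q. J q (R q)) (\<lambda>q. J q (S q)) p"
    if R: "R \<in> \<Gamma>\<^sub>L" and S: "S \<in> \<Gamma>\<^sub>L" for R S
  proof -
    let ?JR = "\<lambda>q. J q (R q)" and ?JS = "\<lambda>q. J q (S q)"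
    note JR = J_iso[OF R] and JS = J_iso[OF S]
    note m = sec_mem[OF iso_sec] and b = br_iso[OF iso_sec]
    have JJ: "(\<lambda>q. J q (J q (R q))) = (\<lambda>q. - R q)" "(\<lambda>q. J q (J q (S q))) = (\<lambda>q. - S q)"
      using J_J m R S by auto
    \<comment> \<open>Two applications of the derivation rule give - [R, S] = - 2 [R, S] + 2
      [JR, JS].\<close>
    have "J p (J p (br R S p)) = J p (br ?JR S p) + J p (br R ?JS p)"
      using J_derivation[OF R S] m b R S JR JS by (simp add: J_add)
    then have "br ?JR ?JS p - br R S p + br ?JR ?JS p = 0"
      using J_derivation[OF JR S] J_derivation[OF R JS] m b R S JR JS
      by (simp add: JJ J_J br_uminus_left br_uminus_right iso_sec)
    then have "br ?JR ?JS p + br ?JR ?JS p = br R S p" by (simp add: algebra_simps)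
    then show ?thesis by (simp add: scaleR_2)
  qed
  have "(\<lambda>q. J q (J q (T q))) = (\<lambda>q. - T q)" if "T \<in> \<Gamma>\<^sub>L" for T
    using J_J sec_mem[OF iso_sec[OF that]] by auto
  with half[OF assms] half[OF J_iso[OF assms(1)] J_iso[OF assms(2)]] assms
  have "br R S p = 2 *\<^sub>R 2 *\<^sub>R br (\<lambda>q. - R q) (\<lambda>q. - S q) p"
    by metis
  also have "br (\<lambda>q. - R q) (\<lambda>q. - S q) p = br R S p"
    using assms by (simp add: br_uminus_left br_uminus_right iso_sec sections_uminus[OF vb])
  finally have "br R S p = (2 * 2) *\<^sub>R br R S p" unfolding scaleR_scaleR .
  then have "(2 * 2 - 1) *\<^sub>R br R S p = 0" by (metis diff_self scaleR_diff_left scaleR_one)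
  then show ?thesis by simp
qed

section \<open>The horizontal lift\<close>

abbreviation hor :: "'m \<Rightarrow> 'v set" where
  "hor \<equiv> horizontal A \<omega>"

abbreviation lift :: "'m \<Rightarrow> 'e \<Rightarrow> 'v" where
  "lift \<equiv> horizontal_lift A \<omega>"

abbreviation J_M :: "'m \<Rightarrow> 'e \<Rightarrow> 'e" where
  "J_M \<equiv> induced_complex A \<omega> J"

text \<open>\<omega>(a, s) = g(a, J s) and J maps L onto itself, so vanishing for all s in L is the
  same condition for both forms. The metric description of E is the one that positivity and
  orthogonal right inverses can use.\<close>

lemma horizontal_iff:
  "a \<in> hor p \<longleftrightarrow> a \<in> fibre A p \<and> (\<forall>s\<in>isotropy A p. g p a s = 0)"
proof -
  have "(\<forall>s\<in>isotropy A p. \<omega> p a s = 0) \<longleftrightarrow> (\<forall>s\<in>isotropy A p. g p a s = 0)"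
    if a: "a \<in> fibre A p"
  proof
    assume w: "\<forall>s\<in>isotropy A p. \<omega> p a s = 0"
    show "\<forall>s\<in>isotropy A p. g p a s = 0"
    proof
      fix s assume s: "s \<in> isotropy A p"
      have "\<omega> p a (J p s) = - g p a s"
        using a isotropy_fibre[OF s] by (simp add: omega_g J_mem J_J g_uminus_right)
      then show "g p a s = 0" using w J_isotropy[OF s] by simp
    qed
  next
    assume "\<forall>s\<in>isotropy A p. g p a s = 0"
    then show "\<forall>s\<in>isotropy A p. \<omega> p a s = 0"
      using a isotropy_fibre J_isotropy by (simp add: omega_g)
  qed
  then show ?thesis unfolding horizontal_def by blast
qed

lemma hor_mem: "a \<in> hor p \<Longrightarrow> a \<in> fibre A p"
  and hor_perp: "a \<in> hor p \<Longrightarrow> s \<in> isotropy A p \<Longrightarrow> g p a s = 0"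
  and hor_omega: "a \<in> hor p \<Longrightarrow> s \<in> isotropy A p \<Longrightarrow> \<omega> p a s = 0"
  using horizontal_iff unfolding horizontal_def by blast+

lemma hor_add: "a \<in> hor p \<Longrightarrow> b \<in> hor p \<Longrightarrow> a + b \<in> hor p"
  and hor_diff: "a \<in> hor p \<Longrightarrow> b \<in> hor p \<Longrightarrow> a - b \<in> hor p"
  and hor_scaleR: "a \<in> hor p \<Longrightarrow> r *\<^sub>R a \<in> hor p"
  by (simp_all add: horizontal_iff g_add_left g_diff_left g_scaleR_left isotropy_fibre)

lemma hor_J:
  assumes "a \<in> hor p"
  shows "J p a \<in> hor p"
  using hor_mem[OF assms] hor_perp[OF assms] J_isotropy
  by (simp add: horizontal_iff J_mem g_J_skew isotropy_fibre)

text \<open>The difference lies in both E and L, hence is orthogonal to itself.\<close>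

lemma hor_anchor_inject:
  assumes "a \<in> hor p" "b \<in> hor p" "anchor A p a = anchor A p b"
  shows "a = b"
proof -
  note d = hor_diff[OF assms(1,2)]
  have "a - b \<in> isotropy A p"
    using assms hor_mem by (simp add: isotropy_def anchor_diff)
  then have "a - b = 0"
    using hor_perp[OF d] hor_mem[OF d] g_zero_imp_zero by blast
  then show ?thesis by simp
qed

section \<open>Smoothness of the horizontal lift\<close>

text \<open>\<open>x\<close> is the constant coordinate vector of a local vector field, and
  \<open>l\<close> is the horizontal lift of that field in the trivialisation. In coordinates the
  anchor is a surjection with kernel L, so the right inverse orthogonal to the kernel takes values
  in E.\<close>

lemma local_horizontal_lift:
  assumes c: "c \<in> M" and W: "(W, \<Psi>) \<in> trivs A"
  obtains l where "smooth_map_on M (fst c \<inter> W) l"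
    "\<And>p. p \<in> fst c \<inter> W \<Longrightarrow> triv_inv A \<Psi> p (l p) \<in> hor p"
    "\<And>p. p \<in> fst c \<inter> W \<Longrightarrow> anchor A p (triv_inv A \<Psi> p (l p)) = inv (tangent_coord M c p) x"
proof -
  let ?V = "fst c \<inter> W"
  let ?G = "\<lambda>p y z. g p (triv_inv A \<Psi> p y) (triv_inv A \<Psi> p z)"
  let ?R = "\<lambda>p y. tangent_coord M c p (anchor A p (triv_inv A \<Psi> p y))"
  note mem = triv_inv_mem[OF vb W]
  have op: "open ?V" using open_chart[OF c] open_triv[OF vb W] by blast
  have bil: "bilinear (?G p)" if "p \<in> ?V" for p
    using bilinear_triv_inv[OF vb g_form W] that by blast
  have sym: "?G p y z = ?G p z y" if "p \<in> ?V" for p y z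
    using g_sym mem that by blast
  have zero: "triv_inv A \<Psi> p y \<noteq> 0" if "p \<in> ?V" "y \<noteq> 0" for p y
    using triv_triv_inv[OF vb W, of p y] triv_triv_inv[OF vb W, of p 0]
      triv_inv_scaleR[OF vb W, of p 0 0] that by auto
  have pos: "?G p y y > 0" if "p \<in> ?V" "y \<noteq> 0" for p y
    using zero[OF that] g_pos mem that by blast
  have sm: "smooth_map_on M ?V (\<lambda>p. ?G p y z)" for y z
  proof -
    have "smooth_map_on M W (\<lambda>p. ?G p y z)" using g_form W unfolding bilinear_form_def by blast
    then show ?thesis by (rule smooth_map_on_subset) blast
  qed
  have lin: "linear (?R p)" if p: "p \<in> ?V" for p
  proof (rule linear_triv_inv[OF vb W])
    show "linear_between (fibre A p) UNIV (\<lambda>a. tangent_coord M c p (anchor A p a))"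
      using anchor_linear[of p] tangent_coord_linear[OF c, of p] p
      by (simp add: linear_between_def linear_add linear_scale)
  qed (use p in simp)
  have surj: "surj (?R p)" if p: "p \<in> ?V" for p
    unfolding surj_def
  proof
    fix v
    have "inv (tangent_coord M c p) v \<in> anchor A p ` fibre A p"
      using transitive unfolding transitive_def by blast
    then obtain a where a: "a \<in> fibre A p" "anchor A p a = inv (tangent_coord M c p) v" by auto
    have "?R p (\<Psi> p a) = v"
      using a p triv_inv_triv[OF vb W _ a(1)] tangent_coord_bij[OF c, of p]
      by (simp add: bij_is_surj surj_f_inv_f)
    then show "\<exists>y. v = ?R p y" by metis
  qed
  have "(fst c, tangent_coord M c) \<in> trivs TM" using c by (simp add: tangent_algebroid_def)
  then have "smooth_map_on M (W \<inter> fst c) (\<lambda>p. ?R p y)" for y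
    using anchor_bundle_map W unfolding bundle_map_def by blast
  then have smR: "smooth_map_on M ?V (\<lambda>p. ?R p y)" for y by (simp add: Int_commute)
  obtain l where l: "smooth_map_on M ?V l" "\<And>p. p \<in> ?V \<Longrightarrow> ?R p (l p) = x"
    "\<And>p y. p \<in> ?V \<Longrightarrow> ?R p y = 0 \<Longrightarrow> ?G p (l p) y = 0"
    using smooth_right_inverse[OF finite_dim_fibre[OF vb] finite_dim_model op bil sym pos sm
        lin surj smR, where x = x] by metis
  show ?thesis
  proof (rule that[OF l(1)])
    fix p assume p: "p \<in> ?V"
    then have pc: "p \<in> fst c" and pW: "p \<in> W" by auto
    have "g p (triv_inv A \<Psi> p (l p)) s = 0" if s: "s \<in> isotropy A p" for s
    proof -
      have "?R p (\<Psi> p s) = 0"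
        using triv_inv_triv[OF vb W pW isotropy_fibre[OF s]] isotropy_anchor[OF s]
          tangent_coord_linear[OF c pc] by (simp add: linear_0)
      from l(3)[OF p this] show ?thesis
        using triv_inv_triv[OF vb W pW isotropy_fibre[OF s]] by simp
    qed
    then show "triv_inv A \<Psi> p (l p) \<in> hor p"
      using mem[OF pW] by (simp add: horizontal_iff)
    show "anchor A p (triv_inv A \<Psi> p (l p)) = inv (tangent_coord M c p) x"
      using l(2)[OF p] tangent_coord_bij[OF c pc] by (metis bij_is_inj inv_f_f)
  qed
qed

text \<open>The local smooth lift, evaluated at \<open>p\<close> on the field with the coordinates
  of \<open>v\<close>, replaces a dimension count for the splitting into E and L.\<close>

lemma horizontal_anchor_surj: "\<exists>a\<in>hor p. anchor A p a = v"
proof -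
  obtain c where c: "c \<in> M" "p \<in> fst c" using charts_cover by blast
  obtain W \<Psi> where W: "(W, \<Psi>) \<in> trivs A" "p \<in> W" using trivs_cover[OF vb] by blast
  obtain l where l:
    "\<And>p. p \<in> fst c \<inter> W \<Longrightarrow> triv_inv A \<Psi> p (l p) \<in> hor p"
    "\<And>q. q \<in> fst c \<inter> W \<Longrightarrow>
      anchor A q (triv_inv A \<Psi> q (l q)) = inv (tangent_coord M c q) (tangent_coord M c p v)"
    using local_horizontal_lift[OF c(1) W(1), of "tangent_coord M c p v"] by metis
  have "inv (tangent_coord M c p) (tangent_coord M c p v) = v"
    using tangent_coord_bij[OF c] by (simp add: bij_is_inj)
  then show ?thesis using l[of p] c(2) W(2) by auto
qed

lemma lift_hor: "lift p v \<in> hor p"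
  and anchor_lift: "anchor A p (lift p v) = v"
proof -
  have "v \<in> anchor A p ` hor p" using horizontal_anchor_surj[of p v] by blast
  then show "lift p v \<in> hor p" "anchor A p (lift p v) = v"
    unfolding horizontal_lift_def by (rule inv_into_into, rule f_inv_into_f)
qed

lemma lift_mem: "lift p v \<in> fibre A p"
  by (rule hor_mem[OF lift_hor])

text \<open>Linearity and smoothness of the lift and its compatibility with J and the bracket all
  come from this uniqueness.\<close>

lemma lift_eqI: "a \<in> hor p \<Longrightarrow> anchor A p a = v \<Longrightarrow> lift p v = a"
  by (rule hor_anchor_inject[OF lift_hor]) (simp_all add: anchor_lift)

lemma lift_add: "lift p (v + w) = lift p v + lift p w"
  by (rule lift_eqI) (simp_all add: hor_add lift_hor anchor_add lift_mem anchor_lift)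

lemma lift_scaleR: "lift p (r *\<^sub>R v) = r *\<^sub>R lift p v"
  by (rule lift_eqI) (simp_all add: hor_scaleR lift_hor anchor_scaleR lift_mem anchor_lift)

lemma lift_bundle_map: "bundle_map M TM A lift"
proof -
  have lin: "linear_between (fibre TM p) (fibre A p) (lift p)" for p
    by (simp add: linear_between_def lift_add lift_scaleR image_subset_iff lift_mem)
  have smooth: "smooth_map_on M (U \<inter> W) (\<lambda>p. \<Psi> p (lift p (triv_inv TM \<Phi> p x)))"
    if U: "(U, \<Phi>) \<in> trivs TM" and W: "(W, \<Psi>) \<in> trivs A" for U \<Phi> W \<Psi> x
  proof -
    from U obtain c where c: "c \<in> M" "U = fst c" "\<Phi> = tangent_coord M c"
      unfolding tangent_algebroid_def by auto
    obtain l where l: "smooth_map_on M (fst c \<inter> W) l"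
      "\<And>p. p \<in> fst c \<inter> W \<Longrightarrow> triv_inv A \<Psi> p (l p) \<in> hor p"
      "\<And>p. p \<in> fst c \<inter> W \<Longrightarrow> anchor A p (triv_inv A \<Psi> p (l p)) = inv (tangent_coord M c p) x"
      using local_horizontal_lift[OF c(1) W, of x] by metis
    have op: "open (fst c \<inter> W)" using open_chart[OF c(1)] open_triv[OF vb W] by blast
    show ?thesis
      unfolding c(2,3)
    proof (rule smooth_map_on_cong[OF op _ l(1)])
      show "l p = \<Psi> p (lift p (triv_inv TM (tangent_coord M c) p x))" if p: "p \<in> fst c \<inter> W" for p
        using lift_eqI[OF l(2)[OF p] l(3)[OF p]] triv_triv_inv[OF vb W] p by simp
    qed
  qed
  show ?thesis unfolding bundle_map_def using lin smooth by blast
qed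

text \<open>Entitles the lift to the first clause of \<open>invariant_metric\<close>, which then
  speaks of brackets with horizontal sections.\<close>

lemma lift_splitting: "splitting M A lift"
  unfolding splitting_def using lift_bundle_map anchor_lift by blast

lemma lift_section: "X \<in> sections M TM \<Longrightarrow> (\<lambda>p. lift p (X p)) \<in> \<Gamma>"
  by (rule bundle_map_section[OF tangent_vector_bundle vb lift_bundle_map])

lemma anchor_sec_lift: "anchor_sec A (\<lambda>p. lift p (X p)) = X"
  by (simp add: anchor_sec_def anchor_lift)

lemma lift_decomposition:
  assumes "S \<in> \<Gamma>"
  obtains X S' where "X \<in> sections M TM" "S' \<in> \<Gamma>\<^sub>L" "S = (\<lambda>p. lift p (X p) + S' p)"
    "X = anchor_sec A S"
proof -
  let ?X = "anchor_sec A S"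
  note X = anchor_sec_section[OF assms]
  have "(\<lambda>p. S p - lift p (?X p)) \<in> \<Gamma>\<^sub>L"
    by (intro isoI sections_diff[OF vb] assms lift_section[OF X])
      (simp add: anchor_diff sec_mem assms lift_mem anchor_lift anchor_sec_def)
  from that[OF X this] show ?thesis by simp
qed

section \<open>The Nijenhuis tensor\<close>

text \<open>In d\<omega>(a, b, T) with T in L, the functions \<omega>(a, T) and \<omega>(b, T)
  vanish identically, \<omega>(a, b) is differentiated along \<rho>(T) = 0, and [a, T], [b, T] stay
  in L, hence pair to zero with E. What is left is \<omega>([a, b], T) = 0.\<close>

lemma horizontal_bracket:
  assumes a: "a \<in> \<Gamma>" "\<And>p. a p \<in> hor p" and b: "b \<in> \<Gamma>" "\<And>p. b p \<in> hor p"
  shows "br a b p \<in> hor p"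
proof -
  obtain X S where X: "X \<in> sections M TM" and S: "S \<in> \<Gamma>\<^sub>L"
    and eq: "br a b = (\<lambda>p. lift p (X p) + S p)"
    using lift_decomposition[OF br_sec[OF a(1) b(1)]] by metis
  have "S p = 0" for p
  proof -
    \<comment> \<open>\<omega>(., J S) = - g(., S), so this test section detects the L-component
      \<open>S\<close> of the bracket by its own length.\<close>
    let ?T = "\<lambda>p. J p (S p)"
    note T = J_iso[OF S]
    have z: "(\<lambda>q. \<omega> q (a q) (?T q)) = (\<lambda>q. 0)" "(\<lambda>q. \<omega> q (b q) (?T q)) = (\<lambda>q. 0)"
      using hor_omega[OF a(2) iso_mem[OF T]] hor_omega[OF b(2) iso_mem[OF T]] by blast+
    have zd: "vf_apply M Y (\<lambda>q. 0) p = 0" for Y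
      by (simp add: vf_apply_def dir_deriv_def comp_def frechet_derivative_const)
    have za: "vf_apply M (anchor_sec A ?T) (\<lambda>q. \<omega> q (a q) (b q)) p = 0"
      unfolding iso_anchor[OF T] by (intro vf_apply_zero omega_smooth a b refl)
    have sw: "\<omega> p s h = 0" if "s \<in> isotropy A p" "h \<in> hor p" for s h
      using hor_perp[OF hor_J[OF that(2)] that(1)] that
      by (simp add: omega_g isotropy_fibre hor_mem g_sym J_mem)
    have "\<omega> p (br a b p) (?T p) = 0"
      using omega_closed[OF a(1) b(1) iso_sec[OF T], of p]
        sw[OF iso_mem[OF br_iso[OF a(1) T]] b(2)] sw[OF iso_mem[OF br_iso[OF b(1) T]] a(2)]
      by (simp add: ext_deriv2_def z zd za)
    moreover have "br a b p \<in> fibre A p" "S p \<in> fibre A p" "?T p \<in> fibre A p"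
      by (simp_all add: sec_mem br_sec a b iso_sec S J_mem)
    ultimately have "g p (br a b p) (S p) = 0"
      by (simp add: omega_g J_J g_uminus_right)
    then have "g p (S p) (S p) = 0"
      using hor_perp[OF lift_hor iso_mem[OF S]] \<open>S p \<in> fibre A p\<close>
      by (simp add: eq g_add_left lift_mem)
    then show "S p = 0" by (rule g_zero_imp_zero[OF \<open>S p \<in> fibre A p\<close>])
  qed
  then show ?thesis using lift_hor by (simp add: eq)
qed

lemma lift_bracket:
  assumes "X \<in> sections M TM" "Y \<in> sections M TM"
  shows "br (\<lambda>p. lift p (X p)) (\<lambda>p. lift p (Y p)) = (\<lambda>p. lift p (vf_bracket M X Y p))"
proof
  fix p
  note l = lift_section[OF assms(1)] lift_section[OF assms(2)]
  show "br (\<lambda>p. lift p (X p)) (\<lambda>p. lift p (Y p)) p = lift p (vf_bracket M X Y p)"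
    using lift_eqI[OF horizontal_bracket[OF l(1) lift_hor l(2) lift_hor] anchor_br[OF l]]
    by (simp add: anchor_sec_lift)
qed

text \<open>Since \<omega>(S, T) = g(S, JT), closedness on (a, S, T) and invariance on the pair (S,
  JT) differentiate the same function along X. Equating them leaves g(S, [a, JT]) = - g([a, T], JS),
  and J moves across g with a sign.\<close>

lemma lift_bracket_J:
  assumes X: "X \<in> sections M TM" and T: "T \<in> \<Gamma>\<^sub>L"
  shows "br (\<lambda>p. lift p (X p)) (\<lambda>p. J p (T p)) p = J p (br (\<lambda>p. lift p (X p)) T p)"
proof -
  let ?a = "\<lambda>p. lift p (X p)" and ?JT = "\<lambda>p. J p (T p)"
  note a = lift_section[OF X] and JT = J_iso[OF T]
  note b = br_iso[OF a] and m = sec_mem[OF iso_sec]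
  let ?V = "\<lambda>p. br ?a ?JT p - J p (br ?a T p)"
  have V: "?V \<in> \<Gamma>\<^sub>L" by (intro iso_diff b J_iso T JT)
  have "?V p = 0"
  proof (rule iso_zeroI[OF V])
    fix S q assume S: "S \<in> \<Gamma>\<^sub>L"
    note mm = m[OF S, of q] m[OF T, of q] m[OF JT, of q] m[OF b[OF S], of q] m[OF b[OF T], of q]
      m[OF b[OF JT], of q]
    have eq: "(\<lambda>q. \<omega> q (S q) (T q)) = (\<lambda>q. g q (S q) (?JT q))"
      using omega_g m S T by blast
    have z: "vf_apply M (anchor_sec A S) (\<lambda>q. \<omega> q (?a q) (T q)) q = 0"
      "vf_apply M (anchor_sec A T) (\<lambda>q. \<omega> q (?a q) (S q)) q = 0"
      unfolding iso_anchor[OF S] iso_anchor[OF T]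
      by (intro vf_apply_zero omega_smooth a iso_sec S T refl)+
    \<comment> \<open>Disposes of the term \<omega>([S, T], a), as [S, T] = 0.\<close>
    have "\<omega> q 0 (?a q) = 0" using g_zero_left[OF J_mem[OF lift_mem]] by (simp add: omega_g lift_mem)
    then have "vf_apply M X (\<lambda>q. g q (S q) (?JT q)) q
        = g q (br ?a S q) (?JT q) - g q (br ?a T q) (J q (S q))"
      using omega_closed[OF a iso_sec[OF S] iso_sec[OF T], of q] mm
      by (simp add: ext_deriv2_def z eq isotropy_bracket_zero[OF S T] anchor_sec_lift omega_g)
    moreover have "vf_apply M X (\<lambda>q. g q (S q) (?JT q)) q
        - g q (br ?a S q) (?JT q) - g q (S q) (br ?a ?JT q) = 0"
      using invariant[unfolded invariant_metric_def, THEN conjunct1, rule_format,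
          OF lift_splitting X S JT, of q]
      unfolding adjoint_connection_def .
    moreover have "g q (br ?a T q) (J q (S q)) = - g q (J q (br ?a T q)) (S q)"
      using g_J_skew mm by simp
    moreover have "g q (S q) (br ?a ?JT q) = g q (br ?a ?JT q) (S q)"
      using g_sym mm by blast
    ultimately show "g q (?V q) (S q) = 0"
      using mm by (simp add: g_diff_left J_mem)
  qed
  then show ?thesis by simp
qed

text \<open>The L-part of \<open>a\<close> brackets to zero with both \<open>T\<close> and
  \<open>JT\<close>, so only the lifted part acts.\<close>

lemma bracket_J_isotropy:
  assumes a: "a \<in> \<Gamma>" and T: "T \<in> \<Gamma>\<^sub>L"
  shows "br a (\<lambda>p. J p (T p)) p = J p (br a T p)"
proof -
  obtain X S where X: "X \<in> sections M TM" and S: "S \<in> \<Gamma>\<^sub>L" and eq: "a = (\<lambda>p. lift p (X p) + S p)"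
    using lift_decomposition[OF a] by metis
  show ?thesis
    unfolding eq
    using lift_bracket_J[OF X T] isotropy_bracket_zero[OF S T] isotropy_bracket_zero[OF S J_iso[OF T]]
    by (simp add: br_add_left lift_section[OF X] iso_sec S T J_iso)
qed

text \<open>For b = a and b = Ja one has [b, JT] = J [b, T]. So [Ja, JT] cancels against J [Ja, T],
  and J [a, JT] = - [a, T] removes the rest.\<close>

lemma nijenhuis_section_isotropy:
  assumes "a \<in> \<Gamma>" "T \<in> \<Gamma>\<^sub>L"
  shows "nijenhuis A J a T p = 0"
  using bracket_J_isotropy[OF assms] bracket_J_isotropy[OF J_sec[OF assms(1)] assms(2)]
  by (simp add: nijenhuis_def Let_def J_J sec_mem br_sec assms iso_sec)

lemma nijenhuis_skew:
  assumes a: "a \<in> \<Gamma>" and b: "b \<in> \<Gamma>"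
  shows "nijenhuis A J a b p = - nijenhuis A J b a p"
proof -
  let ?Ja = "\<lambda>q. J q (a q)" and ?Jb = "\<lambda>q. J q (b q)"
  note Ja = J_sec[OF a] and Jb = J_sec[OF b]
  have "J p (br ?Ja b p) = - J p (br b ?Ja p)" "J p (br a ?Jb p) = - J p (br ?Jb a p)"
    using br_skew[OF Ja b] br_skew[OF a Jb] by (simp_all add: J_uminus sec_mem br_sec a b Ja Jb)
  then show ?thesis
    unfolding nijenhuis_def Let_def using br_skew[OF Ja Jb, of p] br_skew[OF a b, of p] by simp
qed

lemma nijenhuis_add:
  assumes a: "a \<in> \<Gamma>" and b: "b \<in> \<Gamma>" and c: "c \<in> \<Gamma>"
  shows "nijenhuis A J a (\<lambda>q. b q + c q) p = nijenhuis A J a b p + nijenhuis A J a c p"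
proof -
  have eq: "(\<lambda>q. J q (b q + c q)) = (\<lambda>q. J q (b q) + J q (c q))"
    using b c by (simp add: J_add sec_mem)
  show ?thesis
    by (simp add: nijenhuis_def Let_def eq br_add_right J_add sec_mem br_sec J_sec a b c)
qed

lemma nijenhuis_lift:
  assumes S: "S \<in> \<Gamma>" and T: "T \<in> \<Gamma>"
  shows "nijenhuis A J S T p = nijenhuis A J (\<lambda>p. lift p (anchor_sec A S p))
    (\<lambda>p. lift p (anchor_sec A T p)) p"
proof -
  have drop: "nijenhuis A J a T p = nijenhuis A J a (\<lambda>p. lift p (anchor_sec A T p)) p"
    if a: "a \<in> \<Gamma>" and T: "T \<in> \<Gamma>" for a T
  proof -
    obtain T' where X: "anchor_sec A T \<in> sections M TM" and T': "T' \<in> \<Gamma>\<^sub>L"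
      and eq: "T = (\<lambda>p. lift p (anchor_sec A T p) + T' p)"
      using lift_decomposition[OF T] by metis
    show ?thesis
      by (subst eq) (simp add: nijenhuis_add[OF a lift_section[OF X] iso_sec[OF T']]
          nijenhuis_section_isotropy[OF a T'])
  qed
  note l = lift_section[OF anchor_sec_section[OF T]]
  note k = lift_section[OF anchor_sec_section[OF S]]
  show ?thesis
    \<comment> \<open>With a prime for the lift of the anchor: N(S, T) = N(S, T') = - N(T', S) = -
      N(T', S') = N(S', T').\<close>
    using drop[OF S T] drop[OF l S] nijenhuis_skew[OF S l, of p] nijenhuis_skew[OF k l, of p] by simp
qed

section \<open>The induced structure on the base\<close>

text \<open>A structure on the base that witnesses admissibility is determined by its values on
  anchors; evaluating it on lifts identifies it with \<open>J_M\<close>, which thereby inherits its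
  smoothness.\<close>

lemma
  shows induced_almost_complex: "almost_complex M TM J_M"
    and anchor_J: "a \<in> fibre A p \<Longrightarrow> anchor A p (J p a) = J_M p (anchor A p a)"
proof -
  obtain K where K: "almost_complex M TM K"
    "\<And>p a. a \<in> fibre A p \<Longrightarrow> anchor A p (J p a) = K p (anchor A p a)"
    using admissible unfolding admissible_def by blast
  have "J_M = K"
    by (intro ext) (simp add: induced_complex_def K(2) lift_mem anchor_lift)
  with K show "almost_complex M TM J_M"
    "a \<in> fibre A p \<Longrightarrow> anchor A p (J p a) = J_M p (anchor A p a)" by auto
qed

lemma lift_J: "lift p (J_M p v) = J p (lift p v)"
  by (rule lift_eqI) (simp_all add: hor_J lift_hor induced_complex_def)

text \<open>E is closed under J and brackets, so the left side is horizontal and determined by its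
  anchor.\<close>

lemma nijenhuis_anchor:
  assumes X: "X \<in> sections M TM" and Y: "Y \<in> sections M TM"
  shows "nijenhuis A J (\<lambda>p. lift p (X p)) (\<lambda>p. lift p (Y p)) p = lift p (nijenhuis TM J_M X Y p)"
proof (rule sym, rule lift_eqI)
  let ?a = "\<lambda>p. lift p (X p)" and ?b = "\<lambda>p. lift p (Y p)"
  let ?Ja = "\<lambda>p. J p (lift p (X p))" and ?Jb = "\<lambda>p. J p (lift p (Y p))"
  note a = lift_section[OF X] and b = lift_section[OF Y]
  note Ja = J_sec[OF a] and Jb = J_sec[OF b]
  note h = lift_hor hor_J[OF lift_hor]
  show "nijenhuis A J ?a ?b p \<in> hor p"
    unfolding nijenhuis_def Let_def
    by (intro hor_diff hor_J horizontal_bracket a b Ja Jb h)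
  have "anchor_sec A ?Ja = (\<lambda>q. J_M q (X q))" "anchor_sec A ?Jb = (\<lambda>q. J_M q (Y q))"
    by (simp_all add: anchor_sec_def anchor_J lift_mem anchor_lift)
  then show "anchor A p (nijenhuis A J ?a ?b p) = nijenhuis TM J_M X Y p"
    by (simp add: nijenhuis_def Let_def anchor_diff J_mem sec_mem br_sec a b Ja Jb anchor_J anchor_br
        anchor_sec_lift)
qed

text \<open>All bracket identities on \<open>TM\<close> are images under the anchor of those on \<open>A\<close>.\<close>

lemma tangent_lie_algebroid: "lie_algebroid M TM"
proof -
  let ?l = "\<lambda>X p. lift p (X p)"
  \<comment> \<open>Each vector field is the anchor of a global section, namely its lift, so its
    brackets can be computed in \<open>A\<close>.\<close>
  have br: "vf_bracket M X Y = anchor_sec A (br (?l X) (?l Y))"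
    if "X \<in> sections M TM" "Y \<in> sections M TM" for X Y
    using anchor_br'[OF lift_section[OF that(1)] lift_section[OF that(2)]] by (simp add: anchor_sec_lift)
  have sec: "vf_bracket M X Y \<in> sections M TM"
    if "X \<in> sections M TM" "Y \<in> sections M TM" for X Y
    unfolding br[OF that] by (intro anchor_sec_section br_sec lift_section that)
  have add: "vf_bracket M (\<lambda>p. X p + Y p) Z = (\<lambda>p. vf_bracket M X Z p + vf_bracket M Y Z p)"
    if "X \<in> sections M TM" "Y \<in> sections M TM" "Z \<in> sections M TM" for X Y Z
    by (simp add: br that sections_add[OF tangent_vector_bundle] lift_add br_add_left' lift_section
        anchor_sec_def anchor_add sec_mem br_sec)
  have scale: "vf_bracket M (\<lambda>p. r *\<^sub>R X p) Z = (\<lambda>p. r *\<^sub>R vf_bracket M X Z p)"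
    if "X \<in> sections M TM" "Z \<in> sections M TM" for X Z r
    by (simp add: br that sections_scaleR[OF tangent_vector_bundle _ smooth_map_on_const] lift_scaleR
        br_scale_left' lift_section anchor_sec_def anchor_scaleR sec_mem br_sec)
  have skew: "vf_bracket M X Z = (\<lambda>p. - vf_bracket M Z X p)"
    if "X \<in> sections M TM" "Z \<in> sections M TM" for X Z
    using br_skew[OF lift_section[OF that(1)] lift_section[OF that(2)]]
    by (simp add: br that anchor_sec_def anchor_uminus sec_mem br_sec lift_section)
  have jacobi: "vf_bracket M X (vf_bracket M Y Z) p + vf_bracket M Y (vf_bracket M Z X) p
      + vf_bracket M Z (vf_bracket M X Y) p = 0"
    if "X \<in> sections M TM" "Y \<in> sections M TM" "Z \<in> sections M TM" for X Y Z p
  proof -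
    note l = that[THEN lift_section]
    have "anchor A p (br (?l X) (br (?l Y) (?l Z)) p + br (?l Y) (br (?l Z) (?l X)) p
      + br (?l Z) (br (?l X) (?l Y)) p) = 0"
      using br_jacobi[OF l, of p] anchor_zero by simp
    then show ?thesis
      by (simp add: anchor_add sec_mem br_sec l anchor_br anchor_br' anchor_sec_lift)
  qed
  have leibniz: "vf_bracket M X (\<lambda>p. f p *\<^sub>R Y p)
      = (\<lambda>p. f p *\<^sub>R vf_bracket M X Y p + vf_apply M X f p *\<^sub>R Y p)"
    if f: "smooth_map_on M UNIV f" and "X \<in> sections M TM" "Y \<in> sections M TM" for f X Y
    by (simp add: br that sections_scaleR[OF tangent_vector_bundle _ f] lift_scaleR br_leibniz[OF f]
        lift_section anchor_sec_lift)
      (simp add: that anchor_sec_def anchor_add anchor_scaleR sec_mem br_sec lift_section lift_mem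
        anchor_lift)
  show ?thesis
    unfolding lie_algebroid_def anchor_sec_TM bracket_TM
    by (intro conjI ballI allI impI tangent_vector_bundle tangent_anchor_bundle_map sec add scale skew
        jacobi leibniz refl)
qed

lemma induced_bilinear_form:
  assumes b: "bilinear_form M A \<beta>"
  shows "bilinear_form M TM (induced_form A \<omega> \<beta>)"
proof -
  have l: "linear_between (fibre A p) UNIV (\<beta> p a)" "linear_between (fibre A p) UNIV (\<lambda>b. \<beta> p b a)"
    if "a \<in> fibre A p" for a p
    using b that unfolding bilinear_form_def by blast+
  have lin: "linear_between (fibre TM p) UNIV (induced_form A \<omega> \<beta> p a)"
    "linear_between (fibre TM p) UNIV (\<lambda>b. induced_form A \<omega> \<beta> p b a)" for p a
    using l[OF lift_mem, of p a] lift_mem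
    by (simp_all add: linear_between_def induced_form_def lift_add lift_scaleR)
  have "smooth_map_on M U (\<lambda>p. induced_form A \<omega> \<beta> p (triv_inv TM \<Phi> p x) (triv_inv TM \<Phi> p y))"
    if U: "(U, \<Phi>) \<in> trivs TM" for U \<Phi> x y
  proof (rule smooth_map_on_local)
    fix q assume "q \<in> U"
    obtain W \<Psi> where W: "(W, \<Psi>) \<in> trivs A" "q \<in> W" using trivs_cover[OF vb] by blast
    have op: "open (U \<inter> W)"
      using open_triv[OF tangent_vector_bundle U] open_triv[OF vb W(1)] by blast
    have lift_smooth: "smooth_map_on M (U \<inter> W) (\<lambda>p. \<Psi> p (lift p (triv_inv TM \<Phi> p x)))" for x
      using lift_bundle_map U W(1) unfolding bundle_map_def by blast
    have bs: "smooth_map_on M W (\<lambda>p. \<beta> p (triv_inv A \<Psi> p x) (triv_inv A \<Psi> p y))" for x y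
      using b W(1) unfolding bilinear_form_def by blast
    have "smooth_map_on M (U \<inter> W) (\<lambda>p. \<beta> p (triv_inv A \<Psi> p (\<Psi> p (lift p (triv_inv TM \<Phi> p x))))
        (triv_inv A \<Psi> p (\<Psi> p (lift p (triv_inv TM \<Phi> p y)))))"
      by (rule smooth_map_on_apply2[OF finite_dim_fibre[OF vb] op bilinear_triv_inv[OF vb b W(1)]
            smooth_map_on_subset[OF bs] lift_smooth lift_smooth]) auto
    then have "smooth_map_on M (U \<inter> W)
        (\<lambda>p. induced_form A \<omega> \<beta> p (triv_inv TM \<Phi> p x) (triv_inv TM \<Phi> p y))"
      by (rule smooth_map_on_cong[OF op, rotated])
        (simp add: induced_form_def triv_inv_triv[OF vb W(1) _ lift_mem])
    then show "\<exists>V. open V \<and> q \<in> V \<and> smooth_map_on M V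
        (\<lambda>p. induced_form A \<omega> \<beta> p (triv_inv TM \<Phi> p x) (triv_inv TM \<Phi> p y))"
      using op W(2) \<open>q \<in> U\<close> by blast
  qed
  with lin show ?thesis unfolding bilinear_form_def by blast
qed

lemma lift_zero_iff: "lift p v = 0 \<longleftrightarrow> v = 0"
  using anchor_lift[of p v] anchor_zero[of p] lift_scaleR[of p 0 v] by auto

text \<open>Since lifting respects brackets, the exterior derivative of the induced form is that of
  \<omega> evaluated on lifts.\<close>

lemma induced_closed:
  assumes "X \<in> sections M TM" "Y \<in> sections M TM" "Z \<in> sections M TM"
  shows "ext_deriv2 M TM (induced_form A \<omega> \<omega>) X Y Z p = 0"
proof -
  have "ext_deriv2 M TM (induced_form A \<omega> \<omega>) X Y Z p =
    ext_deriv2 M A \<omega> (\<lambda>p. lift p (X p)) (\<lambda>p. lift p (Y p)) (\<lambda>p. lift p (Z p)) p"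
    by (simp add: ext_deriv2_def anchor_sec_lift lift_bracket assms induced_form_def)
  then show ?thesis using omega_closed assms[THEN lift_section] by simp
qed

lemma induced_triple:
  "compatible_triple M TM (induced_form A \<omega> \<omega>) J_M (induced_form A \<omega> g)"
proof -
  \<comment> \<open>The test vector is \<open>J_M p v\<close>, on which the form gives minus the
    squared length of the lift of \<open>v\<close>.\<close>
  have nondeg: "v = 0" if "\<forall>w. induced_form A \<omega> \<omega> p v w = 0" for p v
  proof -
    have "induced_form A \<omega> \<omega> p v (J_M p v) = - g p (lift p v) (lift p v)"
      by (simp add: induced_form_def lift_J omega_g lift_mem J_mem J_J g_uminus_right)
    then show ?thesis
      using that g_zero_imp_zero[OF lift_mem, of p v] by (simp add: lift_zero_iff)
  qed
  have "symplectic_form M TM (induced_form A \<omega> \<omega>)"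
    unfolding symplectic_form_def
    using induced_bilinear_form[OF omega_form] nondeg induced_closed
    by (simp add: induced_form_def omega_alt lift_mem)
  moreover have "riemannian_metric M TM (induced_form A \<omega> g)"
    unfolding riemannian_metric_def using induced_bilinear_form[OF g_form]
    by (simp add: induced_form_def g_sym lift_mem g_pos lift_zero_iff)
  ultimately show ?thesis
    unfolding compatible_triple_def using induced_almost_complex
    by (simp add: induced_form_def lift_J g_J_J omega_g lift_mem)
qed

lemma kahler_iff:
  "kahler M A \<omega> J g \<longleftrightarrow> kahler M TM (induced_form A \<omega> \<omega>) J_M (induced_form A \<omega> g)"
proof -
  \<comment> \<open>The other two conjuncts of \<open>kahler\<close> hold on both sides, so only the
    Nijenhuis conditions are compared.\<close>
  have "(\<forall>S\<in>\<Gamma>. \<forall>T\<in>\<Gamma>. \<forall>p. nijenhuis A J S T p = 0) \<longleftrightarrow>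
    (\<forall>X\<in>sections M TM. \<forall>Y\<in>sections M TM. \<forall>p. nijenhuis TM J_M X Y p = 0)"
  proof (intro iffI ballI allI)
    fix X Y p assume "\<forall>S\<in>\<Gamma>. \<forall>T\<in>\<Gamma>. \<forall>p. nijenhuis A J S T p = 0"
      and "X \<in> sections M TM" "Y \<in> sections M TM"
    then show "nijenhuis TM J_M X Y p = 0"
      using nijenhuis_anchor[of X Y p] lift_section by (simp add: lift_zero_iff)
  next
    fix S T p assume "\<forall>X\<in>sections M TM. \<forall>Y\<in>sections M TM. \<forall>p. nijenhuis TM J_M X Y p = 0"
      and "S \<in> \<Gamma>" "T \<in> \<Gamma>"
    then show "nijenhuis A J S T p = 0"
      by (simp add: nijenhuis_lift nijenhuis_anchor anchor_sec_section lift_zero_iff)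
  qed
  then show ?thesis
    unfolding kahler_def using lie_algebroid tangent_lie_algebroid triple induced_triple by simp
qed

end

theorem theorem3p17:
  fixes M :: "('m::{t2_space,second_countable_topology}, 'e::real_inner) chart set"
    and A :: "('m, 'v::real_vector, 'f::real_inner, 'e) lie_algebroid"
    and \<omega> g :: "'m \<Rightarrow> 'v \<Rightarrow> 'v \<Rightarrow> real"
    and J :: "'m \<Rightarrow> 'v \<Rightarrow> 'v"
  assumes "smooth_manifold M"
    and "lie_algebroid M A"
    and "transitive A"
    and "compatible_triple M A \<omega> J g"
    and "invariant_metric M A g"
    and "admissible M A J"
  shows "(\<forall>S\<in>isotropy_sections M A. \<forall>T\<in>isotropy_sections M A. \<forall>p. bracket A S T p = 0) \<and>
    (kahler M A \<omega> J g \<longleftrightarrow>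
     kahler M (tangent_algebroid M)
       (induced_form A \<omega> \<omega>) (induced_complex A \<omega> J) (induced_form A \<omega> g))"
proof -
  interpret compatible_algebroid M A \<omega> g J
    using assms by unfold_locales
  show ?thesis using isotropy_bracket_zero kahler_iff by blast
qed

end
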